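(* (i) For $n\ge2$, every nonempty shell of $\mathbb Z^n$ and of $\mathrm{Sh}(\mathbb Z^n)$ is a spherical $3$-design. (ii) The following shells are spherical $3\tfrac12$-designs: every nonempty shell of $\mathbb Z^2$ and of $\mathrm{Sh}(\mathbb Z^2)$; $(\mathbb Z^{16})_m$ for $m=2\cdot4^a$, $a\ge0$; $\mathrm{Sh}(\mathbb Z^{16})_m$ for $m=2\cdot4^a$, $a\ge1$; $\mathrm{Sh}(\mathbb Z^{40})_{24}$. (iii) The following shells are spherical $5$-designs: $(\mathbb Z^4)_m$ for $m=2a$, $a\ge1$; $(\mathbb Z^7)_m$ for $m=4^a(8b+3)$, $a,b\ge0$; $\mathrm{Sh}(\mathbb Z^{16})_m$ for $m=4a+2$, $a\ge1$.
   Context: $\mathbb Z^n\subset\mathbb R^n$ is the cubic lattice; its shadow is $\mathrm{Sh}(\mathbb Z^n)=(\mathbb Z+\tfrac12)^n$. For $A\subset\mathbb R^n$, the shell of norm $m$ is $A_m=\{x\in A:\langle x,x\rangle=m\}$. Spherical designs (all sets here are antipodal, $X=-X$): for a nonempty finite antipodal $X$ on a sphere centred at $0$ and $j\ge1$, condition $(C_{2j})$ means $\sum_{x\in X}P(x)=0$ for every homogeneous harmonic polynomial $P$ of degree $2j$ on $\mathbb R^n$. $X$ is a spherical $t$-design ($t$ a positive integer) iff $(C_{2j})$ holds for all $2\le 2j\le t$. $X$ is a spherical $(2s+1+\tfrac12)$-design iff $(C_{2j})$ holds for all $2\le2j\le2s$ and for $2j=2s+4$; thus a $3\tfrac12$-design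 satisfies $(C_2)$ and $(C_6)$. *)

theory Defs
  imports Main Complex_Main
begin

text \<open>Points of R^n are represented as functions nat => real that vanish
 outside the index set {0..<n}.\<close>

definition cubic_shell :: "nat \<Rightarrow> real \<Rightarrow> (nat \<Rightarrow> real) set" where
  "cubic_shell n m = {x. (\<forall>i<n. x i \<in> \<int>) \<and> (\<forall>i\<ge>n. x i = 0) \<and> (\<Sum>i<n. (x i)^2) = m}"

definition shadow_shell :: "nat \<Rightarrow> real \<Rightarrow> (nat \<Rightarrow> real) set" where
  "shadow_shell n m = {x. (\<forall>i<n. x i - 1/2 \<in> \<int>) \<and> (\<forall>i\<ge>n. x i = 0) \<and> (\<Sum>i<n. (x i)^2) = m}"

definition multi_idx :: "nat \<Rightarrow> nat \<Rightarrow> (nat \<Rightarrow> nat) set" where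
  "multi_idx n d = {\<alpha>. (\<forall>i\<ge>n. \<alpha> i = 0) \<and> (\<Sum>i<n. \<alpha> i) = d}"

definition hpoly_eval :: "nat \<Rightarrow> nat \<Rightarrow> ((nat \<Rightarrow> nat) \<Rightarrow> real) \<Rightarrow> (nat \<Rightarrow> real) \<Rightarrow> real" where
  "hpoly_eval n d c x = (\<Sum>\<alpha>\<in>multi_idx n d. c \<alpha> * (\<Prod>i<n. x i ^ \<alpha> i))"

text \<open>Harmonicity: the Laplacian of P vanishes. The coefficient of x^beta
  (beta of degree d-2) in Laplacian(P) is
  sum_i (beta_i+2)(beta_i+1) c(beta + 2 e_i).\<close>
definition harmonic_coeffs :: "nat \<Rightarrow> nat \<Rightarrow> ((nat \<Rightarrow> nat) \<Rightarrow> real) \<Rightarrow> bool" where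
  "harmonic_coeffs n d c \<longleftrightarrow> 2 \<le> d \<and>
     (\<forall>\<beta>\<in>multi_idx n (d - 2).
        (\<Sum>i<n. real ((\<beta> i + 2) * (\<beta> i + 1)) * c (\<beta>(i := \<beta> i + 2))) = 0)"

definition antipodal_spherical :: "nat \<Rightarrow> (nat \<Rightarrow> real) set \<Rightarrow> bool" where
  "antipodal_spherical n X \<longleftrightarrow> finite X \<and> X \<noteq> {} \<and>
     (\<forall>x\<in>X. \<forall>i\<ge>n. x i = 0) \<and>
     (\<forall>x\<in>X. (\<lambda>i. - x i) \<in> X) \<and>
     (\<exists>r. \<forall>x\<in>X. (\<Sum>i<n. (x i)^2) = r)"

definition design_cond :: "nat \<Rightarrow> (nat \<Rightarrow> real) set \<Rightarrow> nat \<Rightarrow> bool" where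
  "design_cond n X k \<longleftrightarrow> (\<forall>c. harmonic_coeffs n k c \<longrightarrow> (\<Sum>x\<in>X. hpoly_eval n k c x) = 0)"

definition sph_design :: "nat \<Rightarrow> (nat \<Rightarrow> real) set \<Rightarrow> nat \<Rightarrow> bool" where
  "sph_design n X t \<longleftrightarrow> antipodal_spherical n X \<and>
     (\<forall>j. 1 \<le> j \<and> 2 * j \<le> t \<longrightarrow> design_cond n X (2 * j))"

text \<open>Spherical (2s+1+1/2)-design.\<close>
definition sph_half_design :: "nat \<Rightarrow> (nat \<Rightarrow> real) set \<Rightarrow> nat \<Rightarrow> bool" where
  "sph_half_design n X s \<longleftrightarrow> antipodal_spherical n X \<and>
     (\<forall>j. 1 \<le> j \<and> 2 * j \<le> 2 * s \<longrightarrow> design_cond n X (2 * j)) \<and>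
     design_cond n X (2 * s + 4)"

end

theory Submission
  imports Defs "HOL-Computational_Algebra.Formal_Power_Series" "HOL-Computational_Algebra.Primes"
begin

unbundle fps_syntax

text \<open>The moments of a shell are coefficients of products of the power series
  sum x^j q^(x^2) over x in Z or Z + 1/2, so they vanish for odd exponents and depend only on the
  multiset of exponents. A moment functional annihilates the harmonic polynomials of a degree if it lies
  in the image of the transposed Laplacian; (C2) is automatic, while (C4) and (C6) each become the
  vanishing of one coefficient, of theta^n times the fourth or sixth cumulant of the ratios
  theta_j / theta_0 (for n = 2, (C6) is automatic too). Writing f for the logarithmic derivative of
  theta, these cumulants are k4 = f' - 2 f^2 and k6 = k4' - 8 f k4.
  With x, y, z (jac2, jac4, jac3 below) the fourth powers of the Jacobi theta constants theta2, theta4,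
  theta3, the relations z = x + y (Jacobi) and f2' + f3' = 4 f2 f3 (Halphen) follow from the 45 degree
  rotation of pairs of integers and half-integers. They turn the two cumulants into xy/8 and xy(y - x)/8 for the cubic
  lattice, and -yz/8 and yz(y + z)/8 for its shadow. The required vanishing then follows from the
  behaviour of x, y, z under q -> -q and q -> q^2. Non-emptiness comes from Lagrange's four-square
  theorem.\<close>

section \<open>Formal power series\<close>

lemma fps_XD_mult: "fps_XD (f * g) = fps_XD f * g + f * fps_XD g" for f g :: "'a::comm_ring_1 fps"
  by (simp add: fps_XD_def algebra_simps)

lemma fps_XD_diff: "fps_XD (f - g) = fps_XD f - fps_XD g" for f g :: "'a::comm_ring_1 fps"
  by (simp add: fps_XD_def algebra_simps)

lemma fps_XD_uminus: "fps_XD (- f) = - fps_XD f" for f :: "'a::comm_ring_1 fps"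
  by (simp add: fps_XD_def)

lemma fps_XD_numeral: "fps_XD (numeral k) = (0 :: 'a::comm_ring_1 fps)"
  by (simp add: fps_XD_def numeral_fps_const)

lemma fps_XD_X: "fps_XD fps_X = (fps_X :: 'a::comm_ring_1 fps)"
  by (simp add: fps_XD_def)

lemma fps_XD_power: "fps_XD (f ^ n) = of_nat n * f ^ (n - 1) * fps_XD f"
  for f :: "'a::comm_ring_1 fps"
  by (simp add: fps_XD_def fps_deriv_power' mult_ac)

lemma fps_XD_eq_0_iff: "fps_XD f = 0 \<longleftrightarrow> f = fps_const (f $ 0)"
  for f :: "'a::{idom, ring_char_0} fps"
proof -
  have "fps_XD f = 0 \<longleftrightarrow> (\<forall>n>0. f $ n = 0)"
    by (simp add: fps_eq_iff) (metis neq0_conv)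
  also have "\<dots> \<longleftrightarrow> f = fps_const (f $ 0)" by (auto simp: fps_eq_iff)
  finally show ?thesis .
qed

lemmas fps_compose_distribs = fps_compose_mult_distrib fps_compose_add_distrib
  fps_compose_sub_distrib fps_compose_uminus fps_compose_power[symmetric]

lemma fps_compose_X_power_nth:
  fixes f :: "'a::comm_ring_1 fps"
  assumes "k > 0"
  shows "(f oo fps_X ^ k) $ n = (if k dvd n then f $ (n div k) else 0)"
proof -
  have "(f oo fps_X ^ k) $ n = (\<Sum>i = 0..n. if i * k = n then f $ i else 0)"
    by (auto simp: fps_compose_nth power_mult[symmetric] fps_X_power_nth mult.commute intro!: sum.cong)
  also have "\<dots> = (if k dvd n then f $ (n div k) else 0)"
  proof (cases "k dvd n")
    case True
    then have "(\<lambda>i. i * k = n) = (\<lambda>i. i = n div k)" using assms by (auto simp: fun_eq_iff)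
    then show ?thesis using True assms by (simp add: fun_eq_iff)
  next
    case False
    then show ?thesis by (auto intro!: sum.neutral)
  qed
  finally show ?thesis .
qed

lemma fps_compose_X_power_inject:
  fixes f g :: "'a::comm_ring_1 fps"
  assumes "k > 0" "f oo fps_X ^ k = g oo fps_X ^ k"
  shows "f = g"
proof (rule fps_ext)
  fix n
  show "f $ n = g $ n"
    using arg_cong[OF assms(2), of "\<lambda>h. h $ (k * n)"] assms(1) by (simp add: fps_compose_X_power_nth)
qed

lemma fps_XD_compose_X_power:
  fixes f :: "'a::comm_ring_1 fps"
  assumes "k > 0"
  shows "fps_XD (f oo fps_X ^ k) = of_nat k * (fps_XD f oo fps_X ^ k)"
  by (rule fps_ext) (use assms in \<open>auto simp: fps_compose_X_power_nth mult.assoc simp flip: fps_of_nat\<close>)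

lemma fps_XD_compose_uminus_X: "fps_XD (f oo - fps_X) = fps_XD f oo - fps_X"
  for f :: "'a::comm_ring_1 fps"
  by (rule fps_ext) (simp add: fps_compose_uminus' mult.left_commute)

lemma fps_compose_uminus_X_twice: "f oo - fps_X oo - fps_X = f" for f :: "'a::comm_ring_1 fps"
  by (rule fps_ext) (simp add: fps_compose_uminus' flip: mult.assoc power_mult_distrib)

lemma fps_compose_even_X_power_uminus_X:
  fixes f :: "'a::comm_ring_1 fps"
  assumes "even k" "k > 0"
  shows "f oo fps_X ^ k oo - fps_X = f oo fps_X ^ k"
  by (rule fps_ext)
    (use assms in \<open>auto simp: fps_compose_uminus' fps_compose_X_power_nth minus_one_power_iff\<close>)

lemma fps_nth_even_part:
  fixes f g :: "'a::comm_ring_1 fps"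
  assumes "f + (f oo - fps_X) = g oo fps_X ^ 2"
  shows "2 * f $ (2 * n) = g $ n"
  using arg_cong[OF assms, of "\<lambda>h. h $ (2 * n)"]
  by (simp add: fps_compose_uminus' fps_compose_X_power_nth)

lemma eq_uminus_self_imp_0:
  fixes x :: "'a::{idom, ring_char_0}"
  assumes "x = - x"
  shows "x = 0"
proof -
  have "2 * x = 0" using assms by (metis mult_2 add.right_inverse)
  then show ?thesis by simp
qed

lemma fps_even_nth_odd:
  fixes f :: "'a::{idom, ring_char_0} fps"
  assumes "f oo - fps_X = f" "odd n"
  shows "f $ n = 0"
proof -
  have "f $ n = - (f $ n)"
    using arg_cong[OF assms(1), of "\<lambda>h. h $ n"] assms(2) by (simp add: fps_compose_uminus')
  then show ?thesis by (rule eq_uminus_self_imp_0)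
qed

lemma fps_odd_nth_even:
  fixes f :: "'a::{idom, ring_char_0} fps"
  assumes "f oo - fps_X = - f" "even n"
  shows "f $ n = 0"
proof -
  have "f $ n = - (f $ n)"
    using arg_cong[OF assms(1), of "\<lambda>h. h $ n"] assms(2) by (simp add: fps_compose_uminus')
  then show ?thesis by (rule eq_uminus_self_imp_0)
qed

section \<open>Generating functions\<close>

definition gen_fun :: "'a set \<Rightarrow> ('a \<Rightarrow> nat) \<Rightarrow> ('a \<Rightarrow> 'b::comm_ring_1) \<Rightarrow> 'b fps" where
  "gen_fun A N w = Abs_fps (\<lambda>n. \<Sum>x | x \<in> A \<and> N x = n. w x)"

definition finite_fibres :: "'a set \<Rightarrow> ('a \<Rightarrow> nat) \<Rightarrow> bool" where
  "finite_fibres A N \<longleftrightarrow> (\<forall>n. finite {x. x \<in> A \<and> N x = n})"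

lemma gen_fun_nth: "gen_fun A N w $ n = (\<Sum>x | x \<in> A \<and> N x = n. w x)"
  by (simp add: gen_fun_def)

lemma gen_fun_cong:
  assumes "\<And>x. x \<in> A \<Longrightarrow> N x = M x" "\<And>x. x \<in> A \<Longrightarrow> w x = v x"
  shows "gen_fun A N w = gen_fun A M v"
  unfolding gen_fun_def using assms
  by (intro arg_cong[of _ _ Abs_fps] ext sum.cong) auto

lemma gen_fun_add: "gen_fun A N (\<lambda>x. w x + v x) = gen_fun A N w + gen_fun A N v"
  by (rule fps_ext) (simp add: gen_fun_nth sum.distrib)

lemma gen_fun_cmult: "gen_fun A N (\<lambda>x. c * w x) = fps_const c * gen_fun A N w"
  by (rule fps_ext) (simp add: gen_fun_nth sum_distrib_left)

lemma bij_betw_fibres: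
  assumes "bij_betw h A B" "\<And>x. x \<in> A \<Longrightarrow> N x = M (h x)"
  shows "bij_betw h {x. x \<in> A \<and> N x = n} {x. x \<in> B \<and> M x = n}"
  using assms unfolding bij_betw_def by (auto intro: inj_on_subset)

lemma gen_fun_bij:
  assumes "bij_betw h A B" "\<And>x. x \<in> A \<Longrightarrow> N x = M (h x)" "\<And>x. x \<in> A \<Longrightarrow> w x = v (h x)"
  shows "gen_fun A N w = gen_fun B M v"
proof (rule fps_ext)
  fix n
  have "bij_betw h {x. x \<in> A \<and> N x = n} {x. x \<in> B \<and> M x = n}"
    using assms(1,2) by (rule bij_betw_fibres)
  from sum.reindex_bij_betw[OF this, of v] show "gen_fun A N w $ n = gen_fun B M v $ n"
    using assms(3) by (simp add: gen_fun_nth)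
qed

lemma finite_fibres_bij:
  assumes "bij_betw h A B" "\<And>x. x \<in> A \<Longrightarrow> N x = M (h x)" "finite_fibres A N"
  shows "finite_fibres B M"
  using bij_betw_finite[OF bij_betw_fibres[of h A B N M, OF assms(1,2)]] assms(3)
  unfolding finite_fibres_def by blast

lemma gen_fun_Un:
  assumes "finite_fibres (A \<union> B) N" "A \<inter> B = {}"
  shows "gen_fun (A \<union> B) N w = gen_fun A N w + gen_fun B N w"
proof (rule fps_ext)
  fix n
  have "{x. x \<in> A \<union> B \<and> N x = n} = {x. x \<in> A \<and> N x = n} \<union> {x. x \<in> B \<and> N x = n}" by auto
  moreover have "finite {x. x \<in> A \<and> N x = n}" "finite {x. x \<in> B \<and> N x = n}"
    using assms(1) by (auto simp: finite_fibres_def intro: rev_finite_subset)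
  ultimately show "gen_fun (A \<union> B) N w $ n = (gen_fun A N w + gen_fun B N w) $ n"
    using assms(2) by (simp add: gen_fun_nth) (subst sum.union_disjoint; auto)
qed

lemma fibre_Times:
  fixes N :: "'a \<Rightarrow> nat" and M :: "'b \<Rightarrow> nat"
  shows "{p. p \<in> A \<times> B \<and> (case p of (x, y) \<Rightarrow> N x + M y) = n} =
   (\<Union>i\<in>{0..n}. {x. x \<in> A \<and> N x = i} \<times> {y. y \<in> B \<and> M y = n - i})"
  by auto

lemma finite_fibres_Times:
  assumes "finite_fibres A N" "finite_fibres B M"
  shows "finite_fibres (A \<times> B) (\<lambda>(x, y). N x + M y)"
  unfolding finite_fibres_def fibre_Times
  using assms by (auto simp: finite_fibres_def)

lemma gen_fun_mult:
  assumes "finite_fibres A N" "finite_fibres B M"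
  shows "gen_fun A N w * gen_fun B M v =
    gen_fun (A \<times> B) (\<lambda>(x, y). N x + M y) (\<lambda>(x, y). w x * v y)"
proof (rule fps_ext)
  fix n
  have "gen_fun (A \<times> B) (\<lambda>(x, y). N x + M y) (\<lambda>(x, y). w x * v y) $ n =
    (\<Sum>i\<in>{0..n}. \<Sum>(x, y)\<in>{x. x \<in> A \<and> N x = i} \<times> {y. y \<in> B \<and> M y = n - i}. w x * v y)"
    unfolding gen_fun_nth fibre_Times using assms
    by (intro sum.UNION_disjoint) (auto simp: finite_fibres_def)
  then show "(gen_fun A N w * gen_fun B M v) $ n =
      gen_fun (A \<times> B) (\<lambda>(x, y). N x + M y) (\<lambda>(x, y). w x * v y) $ n"
    by (simp add: fps_mult_nth gen_fun_nth sum_product sum.cartesian_product)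
qed

lemma gen_fun_XD: "fps_XD (gen_fun A N w) = gen_fun A N (\<lambda>x. of_nat (N x) * w x)"
  by (rule fps_ext) (simp add: gen_fun_nth sum_distrib_left)

lemma gen_fun_X_power_mult: "fps_X ^ c * gen_fun A N w = gen_fun A (\<lambda>x. N x + c) w"
  by (rule fps_ext) (auto simp: gen_fun_nth fps_X_power_mult_nth intro!: sum.cong)

lemma gen_fun_compose_X_power:
  assumes "k > 0"
  shows "gen_fun A N w oo fps_X ^ k = gen_fun A (\<lambda>x. k * N x) w"
  by (rule fps_ext)
    (use assms in \<open>auto simp: gen_fun_nth fps_compose_X_power_nth intro!: sum.cong sum.neutral\<close>)

lemma gen_fun_image:
  assumes "inj_on h A" "k > 0" "\<And>x. x \<in> A \<Longrightarrow> N (h x) = k * M x + c"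
  shows "gen_fun (h ` A) N w = fps_X ^ c * (gen_fun A M (w \<circ> h) oo fps_X ^ k)"
  unfolding gen_fun_compose_X_power[OF assms(2)] gen_fun_X_power_mult
  by (rule gen_fun_bij[OF inj_on_imp_bij_betw[OF assms(1)], symmetric]) (simp_all add: assms(3))

definition coord_vectors :: "nat \<Rightarrow> 'a::zero set \<Rightarrow> (nat \<Rightarrow> 'a) set" where
  "coord_vectors n A = {x. (\<forall>i<n. x i \<in> A) \<and> (\<forall>i\<ge>n. x i = 0)}"

lemma bij_betw_coord_vectors_Suc:
  "bij_betw (\<lambda>(x, a). x(n := a)) (coord_vectors n A \<times> A) (coord_vectors (Suc n) A)"
  by (rule bij_betw_byWitness[where f' = "\<lambda>x. (x(n := 0), x n)"])
    (auto simp: coord_vectors_def fun_eq_iff)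

lemma coord_vectors_0: "coord_vectors 0 A = {\<lambda>_. 0}"
  by (auto simp: coord_vectors_def)

lemma finite_fibres_coord_vectors:
  assumes "finite_fibres A N"
  shows "finite_fibres (coord_vectors n A) (\<lambda>x. \<Sum>i<n. N (x i))"
proof (induction n)
  case 0
  show ?case by (simp add: finite_fibres_def coord_vectors_0)
next
  case (Suc n)
  show ?case
    using finite_fibres_Times[OF Suc.IH assms]
    by (rule finite_fibres_bij[OF bij_betw_coord_vectors_Suc, rotated]) auto
qed

lemma gen_fun_prod:
  assumes "finite_fibres A N"
  shows "(\<Prod>i<n. gen_fun A N (w i)) =
    gen_fun (coord_vectors n A) (\<lambda>x. \<Sum>i<n. N (x i)) (\<lambda>x. \<Prod>i<n. w i (x i))"
proof (induction n)
  case 0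
  have "{x. x = (\<lambda>_. 0 :: 'a) \<and> 0 = n} = (if n = 0 then {\<lambda>_. 0} else {})" for n :: nat by auto
  then show ?case by (simp add: fps_eq_iff gen_fun_nth coord_vectors_0)
next
  case (Suc n)
  have "(\<Prod>i<Suc n. gen_fun A N (w i)) =
      gen_fun (coord_vectors n A \<times> A) (\<lambda>(x, a). (\<Sum>i<n. N (x i)) + N a)
        (\<lambda>(x, a). (\<Prod>i<n. w i (x i)) * w n a)"
    by (simp add: Suc.IH gen_fun_mult[OF finite_fibres_coord_vectors[OF assms] assms])
  also have "\<dots> =
      gen_fun (coord_vectors (Suc n) A) (\<lambda>x. \<Sum>i<Suc n. N (x i)) (\<lambda>x. \<Prod>i<Suc n. w i (x i))"
    by (rule gen_fun_bij[OF bij_betw_coord_vectors_Suc]) auto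
  finally show ?case .
qed

section \<open>Theta series of the integers and half-integers\<close>

definition shifted_ints :: "real \<Rightarrow> real set" where
  "shifted_ints \<delta> = {x. x - \<delta> \<in> \<int>}"

text \<open>On the half-integers this is x^2 - 1/4, so that no fractional powers of q occur.\<close>

definition floor_sq :: "real \<Rightarrow> nat" where
  "floor_sq x = nat \<lfloor>x\<^sup>2\<rfloor>"

definition theta :: "real \<Rightarrow> nat \<Rightarrow> real fps" where
  "theta \<delta> j = gen_fun (shifted_ints \<delta>) floor_sq (\<lambda>x. x ^ j)"

lemma double_in_Ints: "2 * (0 :: real) \<in> \<int>" "2 * (1/2 :: real) \<in> \<int>"
  by simp_all

lemma shifted_ints_add:
  assumes "x \<in> shifted_ints \<alpha>" "y \<in> shifted_ints \<beta>" "\<alpha> + \<beta> - \<gamma> \<in> \<int>"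
  shows "x + y \<in> shifted_ints \<gamma>"
proof -
  have "x + y - \<gamma> = (x - \<alpha>) + (y - \<beta>) + (\<alpha> + \<beta> - \<gamma>)" by simp
  also have "\<dots> \<in> \<int>"
    using assms
    by (intro Ints_add[of "x - \<alpha> + (y - \<beta>)"] Ints_add[of "x - \<alpha>"]) (auto simp: shifted_ints_def)
  finally show ?thesis by (simp add: shifted_ints_def)
qed

lemma shifted_ints_uminus:
  assumes "x \<in> shifted_ints \<alpha>" "\<alpha> + \<beta> \<in> \<int>"
  shows "- x \<in> shifted_ints \<beta>"
proof -
  have "- x - \<beta> = - ((x - \<alpha>) + (\<alpha> + \<beta>))" by simp
  also have "\<dots> \<in> \<int>"
    using assms by (intro Ints_minus Ints_add[of "x - \<alpha>"]) (auto simp: shifted_ints_def)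
  finally show ?thesis by (simp add: shifted_ints_def)
qed

lemma shifted_ints_diff:
  assumes "x \<in> shifted_ints \<alpha>" "y \<in> shifted_ints \<beta>" "\<alpha> - \<beta> - \<gamma> \<in> \<int>"
  shows "x - y \<in> shifted_ints \<gamma>"
  using shifted_ints_add[OF assms(1) shifted_ints_uminus[OF assms(2), of "- \<beta>"], of \<gamma>] assms(3)
  by simp

lemma shifted_ints_disjoint: "shifted_ints 0 \<inter> shifted_ints (1/2) = {}"
proof -
  have False if "x \<in> \<int>" "x - 1/2 \<in> \<int>" for x :: real
  proof -
    have "1/2 = x - (x - 1/2)" by simp
    then have "(1/2 :: real) \<in> \<int>" using that by (metis Ints_diff)
    then show False by (auto elim!: Ints_cases)
  qed
  then show ?thesis by (auto simp: shifted_ints_def)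
qed

lemma half_of_Int_cases:
  fixes x :: real
  assumes "x \<in> \<int>"
  obtains "x / 2 \<in> shifted_ints 0" | "x / 2 \<in> shifted_ints (1/2)"
proof -
  obtain k :: int where x: "x = of_int k" using assms by (elim Ints_cases)
  show thesis
  proof (cases "even k")
    case True
    then obtain l where "k = 2 * l" by (elim evenE)
    with x have "x / 2 = of_int l" by simp
    then show thesis by (intro that(1)) (simp add: shifted_ints_def)
  next
    case False
    then obtain l where "k = 2 * l + 1" by (elim oddE)
    with x have "x / 2 - 1/2 = of_int l" by (simp add: field_simps)
    then show thesis by (intro that(2)) (simp add: shifted_ints_def)
  qed
qed

lemma square_eq_floor_sq:
  assumes "2 * \<delta> \<in> \<int>" "x \<in> shifted_ints \<delta>"
  shows "x\<^sup>2 = real (floor_sq x) + frac (\<delta>\<^sup>2)"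
proof -
  have "x\<^sup>2 - \<delta>\<^sup>2 = (x - \<delta>) * ((x - \<delta>) + 2 * \<delta>)" by (simp add: power2_eq_square algebra_simps)
  also have "\<dots> \<in> \<int>"
    using assms(2) by (intro Ints_mult Ints_add[OF _ assms(1)]) (simp_all add: shifted_ints_def)
  finally obtain k :: int where square_x: "x\<^sup>2 = \<delta>\<^sup>2 + of_int k"
    by (auto elim!: Ints_cases simp: algebra_simps)
  have "real (floor_sq x) = of_int \<lfloor>x\<^sup>2\<rfloor>" by (simp add: floor_sq_def)
  also have "\<dots> = x\<^sup>2 - frac (x\<^sup>2)" by (simp add: frac_def)
  also have "frac (x\<^sup>2) = frac (\<delta>\<^sup>2)" by (simp add: square_x frac_def)
  finally show ?thesis by simp
qed

lemma finite_fibres_shifted_ints: "finite_fibres (shifted_ints \<delta>) floor_sq"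
  unfolding finite_fibres_def
proof
  fix n
  have "x - \<delta> \<in> {k \<in> \<int>. \<bar>k\<bar> \<le> 1 + real n + \<bar>\<delta>\<bar>}" if "x \<in> shifted_ints \<delta>" "floor_sq x = n" for x
  proof -
    have "\<lfloor>x\<^sup>2\<rfloor> = int n" using that(2) by (auto simp: floor_sq_def)
    then have "\<bar>x\<bar>\<^sup>2 < 1 + real n" by (simp add: floor_eq_iff)
    also have "\<dots> \<le> (1 + real n)\<^sup>2" by (simp add: power2_eq_square algebra_simps)
    finally have "\<bar>x\<bar> < 1 + real n" by (rule power_less_imp_less_base) simp
    then show ?thesis using that(1) by (auto simp: shifted_ints_def)
  qed
  then have "{x. x \<in> shifted_ints \<delta> \<and> floor_sq x = n} \<subseteq> (\<lambda>k. k + \<delta>) ` {k \<in> \<int>. \<bar>k\<bar> \<le> 1 + real n + \<bar>\<delta>\<bar>}"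
    by (force intro!: image_eqI[of _ _ "x - \<delta>" for x])
  then show "finite {x. x \<in> shifted_ints \<delta> \<and> floor_sq x = n}"
    using finite_abs_int_segment by (rule finite_subset[OF _ finite_imageI])
qed

lemma theta_XD:
  assumes "2 * \<delta> \<in> \<int>"
  shows "fps_XD (theta \<delta> j) = theta \<delta> (j + 2) - fps_const (frac (\<delta>\<^sup>2)) * theta \<delta> j"
proof -
  have "theta \<delta> (j + 2) = gen_fun (shifted_ints \<delta>) floor_sq
      (\<lambda>x. real (floor_sq x) * x ^ j + frac (\<delta>\<^sup>2) * x ^ j)"
    unfolding theta_def
  proof (rule gen_fun_cong)
    fix x assume "x \<in> shifted_ints \<delta>"
    have "x ^ (j + 2) = x\<^sup>2 * x ^ j" by (simp add: power_add power2_eq_square mult_ac)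
    also have "x\<^sup>2 = real (floor_sq x) + frac (\<delta>\<^sup>2)"
      using assms \<open>x \<in> shifted_ints \<delta>\<close> by (rule square_eq_floor_sq)
    finally show "x ^ (j + 2) = real (floor_sq x) * x ^ j + frac (\<delta>\<^sup>2) * x ^ j"
      by (simp only: distrib_right)
  qed simp
  then show ?thesis
    unfolding gen_fun_add gen_fun_cmult theta_def gen_fun_XD by simp
qed

lemma theta_odd:
  assumes "2 * \<delta> \<in> \<int>" "odd j"
  shows "theta \<delta> j = 0"
proof -
  have uminus: "- x \<in> shifted_ints \<delta>" if "x \<in> shifted_ints \<delta>" for x
    using shifted_ints_uminus[OF that, of \<delta>] assms(1) by simp
  have "bij_betw uminus (shifted_ints \<delta>) (shifted_ints \<delta>)"
    by (rule bij_betw_byWitness[where f' = uminus]) (auto intro: uminus)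
  then have "theta \<delta> j = gen_fun (shifted_ints \<delta>) floor_sq (\<lambda>x. -1 * x ^ j)"
    unfolding theta_def by (rule gen_fun_bij) (use assms(2) in \<open>simp_all add: floor_sq_def\<close>)
  then have "theta \<delta> j = - theta \<delta> j"
    unfolding gen_fun_cmult theta_def by (simp flip: fps_const_neg)
  then have "theta \<delta> j $ n = 0" for n by (metis equal_neg_zero fps_neg_nth)
  then show ?thesis by (simp add: fps_eq_iff)
qed

lemma theta_0_nth: "theta \<delta> 0 $ n = real (card {x \<in> shifted_ints \<delta>. floor_sq x = n})"
  by (simp add: theta_def gen_fun_nth)

lemma theta_nth_0_nonzero: "theta \<delta> 0 $ 0 \<noteq> 0"
proof -
  have "(frac \<delta>)\<^sup>2 < 1" using frac_lt_1[of \<delta>] by (simp add: abs_square_less_1)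
  moreover have "frac \<delta> - \<delta> \<in> \<int>" by (simp add: frac_def)
  ultimately have "frac \<delta> \<in> {x \<in> shifted_ints \<delta>. floor_sq x = 0}"
    by (simp add: shifted_ints_def floor_sq_def floor_le_zero)
  then show ?thesis
    using finite_fibres_shifted_ints[of \<delta>] unfolding theta_0_nth finite_fibres_def
    by (auto simp: card_eq_0_iff)
qed

definition theta_ratio :: "real \<Rightarrow> nat \<Rightarrow> real fps" where
  "theta_ratio \<delta> j = theta \<delta> j * inverse (theta \<delta> 0)"

definition dlog :: "real \<Rightarrow> real fps" where
  "dlog \<delta> = theta_ratio \<delta> 2"

lemma theta_eq_ratio: "theta \<delta> j = theta_ratio \<delta> j * theta \<delta> 0"
  by (simp add: theta_ratio_def mult.assoc inverse_mult_eq_1 theta_nth_0_nonzero)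

lemma theta_ratio_0: "theta_ratio \<delta> 0 = 1"
  by (simp add: theta_ratio_def inverse_mult_eq_1' theta_nth_0_nonzero)

lemma theta_ratio_odd: "2 * \<delta> \<in> \<int> \<Longrightarrow> odd j \<Longrightarrow> theta_ratio \<delta> j = 0"
  by (simp add: theta_ratio_def theta_odd)

lemma theta_0_XD:
  assumes "2 * \<delta> \<in> \<int>"
  shows "fps_XD (theta \<delta> 0) = (dlog \<delta> - fps_const (frac (\<delta>\<^sup>2))) * theta \<delta> 0"
  using theta_XD[OF assms, of 0] theta_eq_ratio[of \<delta> 2]
  by (simp add: dlog_def left_diff_distrib numeral_2_eq_2)

lemma theta_ratio_Suc_Suc:
  assumes "2 * \<delta> \<in> \<int>"
  shows "theta_ratio \<delta> (j + 2) = fps_XD (theta_ratio \<delta> j) + theta_ratio \<delta> j * dlog \<delta>"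
proof -
  have "theta_ratio \<delta> (j + 2) * theta \<delta> 0 = fps_XD (theta \<delta> j) + fps_const (frac (\<delta>\<^sup>2)) * theta \<delta> j"
    using theta_XD[OF assms, of j] by (simp flip: theta_eq_ratio)
  also have "\<dots> = (fps_XD (theta_ratio \<delta> j) + theta_ratio \<delta> j * dlog \<delta>) * theta \<delta> 0"
    unfolding theta_eq_ratio[of \<delta> j] by (simp add: fps_XD_mult theta_0_XD[OF assms] algebra_simps)
  finally show ?thesis using theta_nth_0_nonzero[of \<delta>] by auto
qed

lemma theta_ratio_4:
  assumes "2 * \<delta> \<in> \<int>"
  shows "theta_ratio \<delta> 4 = fps_XD (dlog \<delta>) + dlog \<delta> ^ 2"
  using theta_ratio_Suc_Suc[OF assms, of 2] by (simp add: power2_eq_square flip: dlog_def)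

lemma theta_ratio_6:
  assumes "2 * \<delta> \<in> \<int>"
  shows "theta_ratio \<delta> 6 = fps_XD (fps_XD (dlog \<delta>)) + 3 * dlog \<delta> * fps_XD (dlog \<delta>) + dlog \<delta> ^ 3"
  using theta_ratio_Suc_Suc[OF assms, of 4]
  by (simp add: theta_ratio_4[OF assms] fps_XD_mult power2_eq_square power3_eq_cube algebra_simps)

section \<open>The rotation by 45 degrees\<close>

definition rotate45 :: "real \<times> real \<Rightarrow> real \<times> real" where
  "rotate45 = (\<lambda>(s, t). (s + t, s - t))"

definition pair_floor_sq :: "real \<times> real \<Rightarrow> nat" where
  "pair_floor_sq = (\<lambda>(s, t). floor_sq s + floor_sq t)"

definition pair_theta :: "real \<Rightarrow> real \<Rightarrow> (real \<times> real \<Rightarrow> real) \<Rightarrow> real fps" where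
  "pair_theta \<alpha> \<beta> w = gen_fun (shifted_ints \<alpha> \<times> shifted_ints \<beta>) pair_floor_sq w"

lemma theta_mult: "theta \<alpha> j * theta \<beta> k = pair_theta \<alpha> \<beta> (\<lambda>(s, t). s ^ j * t ^ k)"
  unfolding theta_def pair_theta_def pair_floor_sq_def
  by (rule gen_fun_mult[OF finite_fibres_shifted_ints finite_fibres_shifted_ints])

lemma pair_theta_one: "pair_theta \<alpha> \<beta> (\<lambda>_. 1) = theta \<alpha> 0 * theta \<beta> 0"
  by (simp add: theta_mult case_prod_unfold)

lemma inj_rotate45: "inj rotate45"
  by (auto simp: inj_def rotate45_def)

lemma pair_floor_sq_rotate45:
  assumes "2 * \<alpha> \<in> \<int>" "2 * \<beta> \<in> \<int>" "2 * \<gamma> \<in> \<int>" "\<alpha> + \<beta> - \<gamma> \<in> \<int>" "\<alpha> - \<beta> - \<gamma> \<in> \<int>"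
    and "frac (\<alpha>\<^sup>2) + frac (\<beta>\<^sup>2) = frac (\<gamma>\<^sup>2) + real c / 2"
    and "p \<in> shifted_ints \<alpha> \<times> shifted_ints \<beta>"
  shows "pair_floor_sq (rotate45 p) = 2 * pair_floor_sq p + c"
proof -
  obtain s t where p: "p = (s, t)" and s: "s \<in> shifted_ints \<alpha>" and t: "t \<in> shifted_ints \<beta>"
    using assms(7) by blast
  have sum_mem: "s + t \<in> shifted_ints \<gamma>" using s t assms(4) by (rule shifted_ints_add)
  have diff_mem: "s - t \<in> shifted_ints \<gamma>" using s t assms(5) by (rule shifted_ints_diff)
  have "(s + t)\<^sup>2 + (s - t)\<^sup>2 = 2 * (s\<^sup>2 + t\<^sup>2)" by (simp add: power2_eq_square algebra_simps)
  then have "real (floor_sq (s + t)) + real (floor_sq (s - t)) =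
      2 * (real (floor_sq s) + real (floor_sq t)) + real c"
    unfolding square_eq_floor_sq[OF assms(1) s] square_eq_floor_sq[OF assms(2) t]
      square_eq_floor_sq[OF assms(3) sum_mem] square_eq_floor_sq[OF assms(3) diff_mem]
    using assms(6) by (simp add: field_simps)
  then have "real (pair_floor_sq (rotate45 p)) = real (2 * pair_floor_sq p + c)"
    by (simp add: p rotate45_def pair_floor_sq_def)
  then show ?thesis by (simp only: of_nat_eq_iff)
qed

lemma gen_fun_rotate45_image:
  assumes "2 * \<alpha> \<in> \<int>" "2 * \<beta> \<in> \<int>" "2 * \<gamma> \<in> \<int>" "\<alpha> + \<beta> - \<gamma> \<in> \<int>" "\<alpha> - \<beta> - \<gamma> \<in> \<int>"
    and "frac (\<alpha>\<^sup>2) + frac (\<beta>\<^sup>2) = frac (\<gamma>\<^sup>2) + real c / 2"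
  shows "gen_fun (rotate45 ` (shifted_ints \<alpha> \<times> shifted_ints \<beta>)) pair_floor_sq w =
    fps_X ^ c * (pair_theta \<alpha> \<beta> (w \<circ> rotate45) oo fps_X ^ 2)"
  unfolding pair_theta_def
  by (rule gen_fun_image)
    (use pair_floor_sq_rotate45[OF assms] in \<open>auto intro: inj_on_subset[OF inj_rotate45]\<close>)

lemma rotate45_in_Times:
  assumes "p \<in> shifted_ints \<alpha> \<times> shifted_ints \<beta>" "\<alpha> + \<beta> - \<gamma> \<in> \<int>" "\<alpha> - \<beta> - \<gamma> \<in> \<int>"
  shows "rotate45 p \<in> shifted_ints \<gamma> \<times> shifted_ints \<gamma>"
  using assms shifted_ints_add[of _ \<alpha> _ \<beta> \<gamma>] shifted_ints_diff[of _ \<alpha> _ \<beta> \<gamma>]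
  by (cases p) (simp add: rotate45_def)

lemma mem_rotate45_imageI:
  assumes "(u + v) / 2 \<in> shifted_ints \<alpha>" "v \<in> shifted_ints \<gamma>" "\<alpha> - \<gamma> - \<beta> \<in> \<int>"
  shows "(u, v) \<in> rotate45 ` (shifted_ints \<alpha> \<times> shifted_ints \<beta>)"
proof -
  have "(u, v) = rotate45 ((u + v) / 2, (u + v) / 2 - v)" by (simp add: rotate45_def field_simps)
  moreover have "(u + v) / 2 - v \<in> shifted_ints \<beta>" using assms by (rule shifted_ints_diff)
  ultimately show ?thesis using assms(1) by blast
qed

lemma shifted_ints_Times_eq_rotate45:
  assumes "2 * \<gamma> \<in> \<int>"
  shows "shifted_ints \<gamma> \<times> shifted_ints \<gamma> =
    rotate45 ` (shifted_ints 0 \<times> shifted_ints \<gamma>) \<union>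
    rotate45 ` (shifted_ints (1/2) \<times> shifted_ints (1/2 - \<gamma>))"
  (is "?S \<times> ?S = rotate45 ` (?Z \<times> ?S) \<union> rotate45 ` (?H \<times> ?T)")
proof (rule equalityI; rule subsetI)
  have minus_double: "- (2 * \<gamma>) \<in> \<int>" using assms by (rule Ints_minus)
  fix p assume "p \<in> ?S \<times> ?S"
  then obtain u v where p: "p = (u, v)" and u: "u \<in> ?S" and v: "v \<in> ?S" by blast
  have "u + v \<in> shifted_ints 0" using u v by (rule shifted_ints_add) (use assms in simp)
  then have "u + v \<in> \<int>" by (simp add: shifted_ints_def)
  then show "p \<in> rotate45 ` (?Z \<times> ?S) \<union> rotate45 ` (?H \<times> ?T)"
    unfolding p
    by (cases rule: half_of_Int_cases) (use minus_double in \<open>simp_all add: mem_rotate45_imageI[OF _ v]\<close>)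
next
  have minus_double: "- (2 * \<gamma>) \<in> \<int>" using assms by (rule Ints_minus)
  fix p assume "p \<in> rotate45 ` (?Z \<times> ?S) \<union> rotate45 ` (?H \<times> ?T)"
  then show "p \<in> ?S \<times> ?S"
    using rotate45_in_Times[of _ 0 \<gamma> \<gamma>] rotate45_in_Times[of _ "1/2" "1/2 - \<gamma>" \<gamma>] minus_double
    by (elim UnE imageE) simp_all
qed

lemma frac_half_square: "frac ((1/2 :: real)\<^sup>2) = 1/4"
  by (simp add: frac_eq power2_eq_square)

lemma pair_theta_rotate45:
  assumes "2 * \<gamma> \<in> \<int>" "1/4 + frac ((1/2 - \<gamma>)\<^sup>2) = frac (\<gamma>\<^sup>2) + real c / 2"
  shows "pair_theta \<gamma> \<gamma> w = (pair_theta 0 \<gamma> (w \<circ> rotate45) oo fps_X ^ 2) +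
    fps_X ^ c * (pair_theta (1/2) (1/2 - \<gamma>) (w \<circ> rotate45) oo fps_X ^ 2)"
proof -
  let ?A = "rotate45 ` (shifted_ints 0 \<times> shifted_ints \<gamma>)"
    and ?B = "rotate45 ` (shifted_ints (1/2) \<times> shifted_ints (1/2 - \<gamma>))"
  have "finite_fibres (?A \<union> ?B) pair_floor_sq"
    unfolding shifted_ints_Times_eq_rotate45[OF assms(1), symmetric] pair_floor_sq_def
    by (intro finite_fibres_Times finite_fibres_shifted_ints)
  moreover have "?A \<inter> ?B = {}"
    using shifted_ints_disjoint by (auto simp flip: image_Int[OF inj_rotate45])
  ultimately have "pair_theta \<gamma> \<gamma> w = gen_fun ?A pair_floor_sq w + gen_fun ?B pair_floor_sq w"
    unfolding pair_theta_def shifted_ints_Times_eq_rotate45[OF assms(1)] by (rule gen_fun_Un)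
  moreover have "gen_fun ?A pair_floor_sq w =
      fps_X ^ 0 * (pair_theta 0 \<gamma> (w \<circ> rotate45) oo fps_X ^ 2)"
    using assms(1) Ints_minus[OF assms(1)] by (intro gen_fun_rotate45_image) simp_all
  moreover have "gen_fun ?B pair_floor_sq w =
      fps_X ^ c * (pair_theta (1/2) (1/2 - \<gamma>) (w \<circ> rotate45) oo fps_X ^ 2)"
    using assms Ints_minus[OF assms(1)]
    by (intro gen_fun_rotate45_image) (simp_all add: frac_half_square right_diff_distrib)
  ultimately show ?thesis by simp
qed

lemma pair_theta_half_Ints:
  "pair_theta (1/2) (1/2) w = (pair_theta 0 (1/2) (w \<circ> rotate45) oo fps_X ^ 2) +
    (pair_theta (1/2) 0 (w \<circ> rotate45) oo fps_X ^ 2)"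
  using pair_theta_rotate45[of "1/2" 0 w] by (simp add: frac_half_square)

lemma theta_half_square: "theta (1/2) 0 ^ 2 = 2 * ((theta (1/2) 0 * theta 0 0) oo fps_X ^ 2)"
  using pair_theta_half_Ints[of "\<lambda>_. 1"]
  by (simp add: comp_def pair_theta_one power2_eq_square mult.commute flip: mult_2)

lemma theta_int_square:
  "theta 0 0 ^ 2 = (theta 0 0 oo fps_X ^ 2) ^ 2 + fps_X * (theta (1/2) 0 oo fps_X ^ 2) ^ 2"
  using pair_theta_rotate45[of 0 1 "\<lambda>_. 1"]
  by (simp add: comp_def pair_theta_one power2_eq_square fps_compose_mult_distrib frac_half_square)

text \<open>The real part of (s + it)^4, which is multiplied by -4 under the rotation (scaled by the
  square root of 2).\<close>

definition quartic_weight :: "real \<times> real \<Rightarrow> real" where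
  "quartic_weight = (\<lambda>(s, t). s ^ 4 - 6 * (s ^ 2 * t ^ 2) + t ^ 4)"

lemma pair_theta_quartic:
  "pair_theta \<alpha> \<beta> (\<lambda>p. c * quartic_weight p) =
    fps_const c * (theta \<alpha> 4 * theta \<beta> 0 - 6 * (theta \<alpha> 2 * theta \<beta> 2) + theta \<alpha> 0 * theta \<beta> 4)"
proof -
  have monomials: "quartic_weight = (\<lambda>p. ((case p of (s, t) \<Rightarrow> s ^ 4 * t ^ 0)
      + (-6) * (case p of (s, t) \<Rightarrow> s ^ 2 * t ^ 2)) + (case p of (s, t) \<Rightarrow> s ^ 0 * t ^ 4))"
    by (auto simp: quartic_weight_def)
  have "pair_theta \<alpha> \<beta> quartic_weight =
      theta \<alpha> 4 * theta \<beta> 0 + fps_const (-6) * (theta \<alpha> 2 * theta \<beta> 2) + theta \<alpha> 0 * theta \<beta> 4"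
    unfolding theta_mult pair_theta_def monomials gen_fun_add gen_fun_cmult ..
  then have "pair_theta \<alpha> \<beta> quartic_weight =
      theta \<alpha> 4 * theta \<beta> 0 - 6 * (theta \<alpha> 2 * theta \<beta> 2) + theta \<alpha> 0 * theta \<beta> 4"
    by (simp add: numeral_fps_const flip: fps_const_neg)
  then show ?thesis by (simp only: pair_theta_def gen_fun_cmult)
qed

lemma theta_half_quartic:
  "theta (1/2) 0 * theta (1/2) 4 - 3 * theta (1/2) 2 ^ 2 = - 4 *
    ((theta 0 4 * theta (1/2) 0 - 6 * theta 0 2 * theta (1/2) 2 + theta 0 0 * theta (1/2) 4) oo fps_X ^ 2)"
  (is "?lhs = - 4 * (?Q oo fps_X ^ 2)")
proof -
  have rotate: "quartic_weight \<circ> rotate45 = (\<lambda>p. (-4) * quartic_weight p)"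
    by (auto simp: quartic_weight_def rotate45_def power4_eq_xxxx power2_eq_square algebra_simps)
  have "2 * ?lhs = pair_theta (1/2) (1/2) (\<lambda>p. 1 * quartic_weight p)"
    unfolding pair_theta_quartic by (simp add: power2_eq_square algebra_simps)
  also have "\<dots> = 2 * (- 4 * (?Q oo fps_X ^ 2))"
    unfolding mult_1 pair_theta_half_Ints rotate pair_theta_quartic
    by (simp add: fps_compose_distribs numeral_fps_const algebra_simps flip: fps_const_neg)
  finally show ?thesis by (simp only: mult_cancel_left) simp
qed

lemma Ints_eq_double: "shifted_ints 0 = (*) 2 ` shifted_ints 0 \<union> (*) 2 ` shifted_ints (1/2)"
proof (rule equalityI; rule subsetI)
  fix x :: real assume "x \<in> shifted_ints 0"
  then have "x \<in> \<int>" by (simp add: shifted_ints_def)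
  then have "2 * (x / 2) \<in> (*) 2 ` shifted_ints 0 \<union> (*) 2 ` shifted_ints (1/2)"
    by (cases rule: half_of_Int_cases) blast+
  then show "x \<in> (*) 2 ` shifted_ints 0 \<union> (*) 2 ` shifted_ints (1/2)" by simp
next
  have double: "2 * x \<in> shifted_ints 0" if "x \<in> shifted_ints \<delta>" "\<delta> + \<delta> - 0 \<in> \<int>" for x \<delta>
    unfolding mult_2 using that(1,1,2) by (rule shifted_ints_add)
  fix x :: real assume "x \<in> (*) 2 ` shifted_ints 0 \<union> (*) 2 ` shifted_ints (1/2)"
  then show "x \<in> shifted_ints 0" using double[of _ 0] double[of _ "1/2"] by (elim UnE imageE) simp_all
qed

lemma theta_int_double:
  "theta 0 0 = (theta 0 0 oo fps_X ^ 4) + fps_X * (theta (1/2) 0 oo fps_X ^ 4)"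
proof -
  let ?Z = "shifted_ints 0" and ?H = "shifted_ints (1/2)"
  have floor_sq_double: "floor_sq (2 * x) = 4 * floor_sq x + c"
    if "2 * \<delta> \<in> \<int>" "x \<in> shifted_ints \<delta>" "4 * frac (\<delta>\<^sup>2) = real c" for x \<delta> c
  proof -
    have "2 * x \<in> shifted_ints 0" using shifted_ints_add[OF that(2,2), of 0] that(1) by simp
    from square_eq_floor_sq[OF _ this] have "real (floor_sq (2 * x)) = 4 * x\<^sup>2"
      by (simp add: power_mult_distrib)
    also have "\<dots> = real (4 * floor_sq x + c)" using square_eq_floor_sq[OF that(1,2)] that(3) by simp
    finally show ?thesis by (simp only: of_nat_eq_iff)
  qed
  have "finite_fibres ((*) 2 ` ?Z \<union> (*) 2 ` ?H) floor_sq"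
    unfolding Ints_eq_double[symmetric] by (rule finite_fibres_shifted_ints)
  moreover have "(*) 2 ` ?Z \<inter> (*) 2 ` ?H = {}" using shifted_ints_disjoint by auto
  ultimately have "theta 0 0 =
      gen_fun ((*) 2 ` ?Z) floor_sq (\<lambda>_. 1) + gen_fun ((*) 2 ` ?H) floor_sq (\<lambda>_. 1)"
    unfolding theta_def power_0 by (subst Ints_eq_double) (rule gen_fun_Un)
  also have "gen_fun ((*) 2 ` ?Z) floor_sq (\<lambda>_. 1) = fps_X ^ 0 * (theta 0 0 oo fps_X ^ 4)"
    using gen_fun_image[of "(*) 2" ?Z 4 floor_sq floor_sq 0 "\<lambda>_. 1"] floor_sq_double[of 0 _ 0]
    by (simp add: theta_def comp_def inj_on_def)
  also have "gen_fun ((*) 2 ` ?H) floor_sq (\<lambda>_. 1) = fps_X ^ 1 * (theta (1/2) 0 oo fps_X ^ 4)"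
    using gen_fun_image[of "(*) 2" ?H 4 floor_sq floor_sq 1 "\<lambda>_. 1"] floor_sq_double[of "1/2" _ 1]
    by (simp add: theta_def comp_def inj_on_def frac_half_square)
  finally show ?thesis by simp
qed

section \<open>The relations of Jacobi and Halphen\<close>

abbreviation theta2 :: "real fps" where "theta2 \<equiv> theta (1/2) 0"
abbreviation theta3 :: "real fps" where "theta3 \<equiv> theta 0 0"
definition theta4 :: "real fps" where "theta4 = theta3 oo - fps_X"

abbreviation dlog2 :: "real fps" where "dlog2 \<equiv> dlog (1/2)"
abbreviation dlog3 :: "real fps" where "dlog3 \<equiv> dlog 0"
definition dlog4 :: "real fps" where "dlog4 = dlog3 oo - fps_X"

text \<open>These are the fourth powers of the classical theta constants; theta2 lacks the classical
  factor q^(1/4), whence the factor X in jac2 and the extra 1/4 in dlog2.\<close>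

definition jac2 :: "real fps" where "jac2 = fps_X * theta2 ^ 4"
definition jac3 :: "real fps" where "jac3 = theta3 ^ 4"
definition jac4 :: "real fps" where "jac4 = theta4 ^ 4"

lemma theta3_nth_0: "theta3 $ 0 = 1"
proof -
  have "x = 0" if "x \<in> shifted_ints 0" "floor_sq x = 0" for x
    using square_eq_floor_sq[OF double_in_Ints(1) that(1)] that(2) by simp
  then have "{x \<in> shifted_ints 0. floor_sq x = 0} = {0}"
    by (auto simp: shifted_ints_def floor_sq_def)
  then show ?thesis by (simp add: theta_0_nth)
qed

lemma theta2_nth_0: "theta2 $ 0 = 2"
proof -
  have "x \<in> {1/2, -1/2}" if "x \<in> shifted_ints (1/2)" "floor_sq x = 0" for x
  proof -
    have "x\<^sup>2 = (1/2)\<^sup>2"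
      using square_eq_floor_sq[OF double_in_Ints(2) that(1)] that(2)
      by (simp add: frac_half_square power2_eq_square)
    then show ?thesis unfolding power2_eq_iff by auto
  qed
  moreover have "{1/2, -1/2} \<subseteq> {x \<in> shifted_ints (1/2). floor_sq x = 0}"
    by (simp add: shifted_ints_def floor_sq_def power2_eq_square)
  ultimately have "{x \<in> shifted_ints (1/2). floor_sq x = 0} = {1/2, -1/2}" by blast
  then show ?thesis by (simp add: theta_0_nth)
qed

lemma theta4_nth_0: "theta4 $ 0 = 1"
  by (simp add: theta4_def theta3_nth_0)

lemma theta_nonzero: "theta2 \<noteq> 0" "theta3 \<noteq> 0" "theta4 \<noteq> 0"
  using theta2_nth_0 theta3_nth_0 theta4_nth_0 by auto

lemma jac_nonzero: "jac2 \<noteq> 0" "jac3 \<noteq> 0" "jac4 \<noteq> 0"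
  using theta_nonzero by (simp_all add: jac2_def jac3_def jac4_def)

lemma theta2_square: "theta2 ^ 2 = 2 * (theta2 oo fps_X ^ 2) * (theta3 oo fps_X ^ 2)"
  using theta_half_square by (simp add: fps_compose_distribs)

lemma theta4_square: "theta4 ^ 2 = (theta3 oo fps_X ^ 2) ^ 2 - fps_X * (theta2 oo fps_X ^ 2) ^ 2"
proof -
  have "theta4 ^ 2 = theta3 ^ 2 oo - fps_X" by (simp add: theta4_def fps_compose_power)
  then show ?thesis
    unfolding theta_int_square by (simp add: fps_compose_distribs fps_compose_even_X_power_uminus_X)
qed

theorem jacobi: "jac3 = jac2 + jac4"
proof -
  have squares: "jac3 = (theta3 ^ 2) ^ 2" "jac4 = (theta4 ^ 2) ^ 2" "jac2 = fps_X * (theta2 ^ 2) ^ 2"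
    by (simp_all add: jac2_def jac3_def jac4_def flip: power_mult)
  show ?thesis
    unfolding squares theta_int_square theta4_square theta2_square
    by (simp add: power2_eq_square algebra_simps)
qed

lemma theta2_uminus_X: "theta2 oo - fps_X = theta2"
proof -
  have "(theta2 oo - fps_X) ^ 2 = theta2 ^ 2 oo - fps_X" by (simp add: fps_compose_power)
  also have "\<dots> = theta2 ^ 2"
    unfolding theta2_square by (simp add: fps_compose_distribs fps_compose_even_X_power_uminus_X)
  finally have "theta2 oo - fps_X = theta2 \<or> theta2 oo - fps_X = - theta2" by (simp only: power2_eq_iff)
  moreover have "(theta2 oo - fps_X) $ 0 \<noteq> (- theta2) $ 0" by (simp add: theta2_nth_0)
  ultimately show ?thesis by metis
qed

lemma jac_uminus_X: "jac2 oo - fps_X = - jac2" "jac3 oo - fps_X = jac4" "jac4 oo - fps_X = jac3"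
  by (simp_all add: jac2_def jac3_def jac4_def theta4_def fps_compose_distribs
      fps_compose_uminus_X_twice theta2_uminus_X)

lemma theta3_theta4: "theta3 * theta4 = (theta4 oo fps_X ^ 2) ^ 2"
proof -
  have "(theta3 * theta4) ^ 2 = (jac3 - jac2) oo fps_X ^ 2"
    by (simp add: power_mult_distrib theta_int_square theta4_square jac3_def jac2_def
        fps_compose_distribs)
      (simp add: power2_eq_square power4_eq_xxxx algebra_simps)
  also have "\<dots> = ((theta4 oo fps_X ^ 2) ^ 2) ^ 2"
    by (simp add: jacobi jac4_def fps_compose_distribs flip: power_mult)
  finally have "theta3 * theta4 = (theta4 oo fps_X ^ 2) ^ 2 \<or>
      theta3 * theta4 = - ((theta4 oo fps_X ^ 2) ^ 2)"
    by (simp only: power2_eq_iff)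
  moreover have "(theta3 * theta4) $ 0 \<noteq> (- ((theta4 oo fps_X ^ 2) ^ 2)) $ 0"
    by (simp add: theta3_nth_0 theta4_nth_0 power2_eq_square)
  ultimately show ?thesis by metis
qed

lemma jac2_square: "jac2 ^ 2 = 16 * ((jac2 * jac3) oo fps_X ^ 2)"
proof -
  have "jac2 ^ 2 = fps_X ^ 2 * (theta2 ^ 2) ^ 4"
    by (simp add: jac2_def power_mult_distrib flip: power_mult)
  then show ?thesis
    by (simp add: theta2_square jac2_def jac3_def fps_compose_distribs power_mult_distrib)
qed

lemma jac4_mult_jac3: "jac4 * jac3 = jac4 ^ 2 oo fps_X ^ 2"
proof -
  have "jac4 * jac3 = (theta3 * theta4) ^ 4" by (simp add: jac3_def jac4_def power_mult_distrib)
  then show ?thesis by (simp add: theta3_theta4 jac4_def fps_compose_distribs flip: power_mult)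
qed

lemma jac4_add_jac3: "jac4 + jac3 = 2 * ((jac2 + jac3) oo fps_X ^ 2)"
proof -
  have "jac4 + jac3 = (theta4 ^ 2) ^ 2 + (theta3 ^ 2) ^ 2"
    by (simp add: jac3_def jac4_def flip: power_mult)
  then show ?thesis
    by (simp add: theta_int_square theta4_square jac2_def jac3_def fps_compose_distribs)
      (simp add: power2_eq_square power4_eq_xxxx algebra_simps)
qed

lemma theta2_XD: "fps_XD theta2 = (dlog2 - fps_const (1/4)) * theta2"
  using theta_0_XD[OF double_in_Ints(2)] by (simp add: frac_half_square)

lemma theta3_XD: "fps_XD theta3 = dlog3 * theta3"
  using theta_0_XD[OF double_in_Ints(1)] by simp

lemma theta4_XD: "fps_XD theta4 = dlog4 * theta4"
  by (simp add: theta4_def dlog4_def fps_XD_compose_uminus_X theta3_XD fps_compose_mult_distrib)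

lemma jac_XD:
  "fps_XD jac2 = 4 * dlog2 * jac2" "fps_XD jac3 = 4 * dlog3 * jac3" "fps_XD jac4 = 4 * dlog4 * jac4"
proof -
  have "fps_const (1/4 :: real) * 4 = 1"
    by (simp add: numeral_fps_const flip: fps_const_1_eq_1)
  moreover have "fps_XD jac2 = 4 * dlog2 * jac2 + (1 - fps_const (1/4) * 4) * jac2"
    by (simp add: jac2_def fps_XD_mult fps_XD_power fps_XD_X theta2_XD power_eq_if algebra_simps)
  ultimately show "fps_XD jac2 = 4 * dlog2 * jac2" by simp
  show "fps_XD jac3 = 4 * dlog3 * jac3" "fps_XD jac4 = 4 * dlog4 * jac4"
    by (simp_all add: jac3_def jac4_def fps_XD_power theta3_XD theta4_XD)
      (simp_all add: power4_eq_xxxx power3_eq_cube)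
qed

lemma jacobi_XD: "jac2 * (dlog2 - dlog3) = jac4 * (dlog3 - dlog4)"
proof -
  have "4 * dlog3 * (jac2 + jac4) = 4 * dlog2 * jac2 + 4 * dlog4 * jac4"
    using arg_cong[OF jacobi, of fps_XD] by (simp only: jac_XD fps_XD_add) (simp only: jacobi)
  then have "4 * (jac2 * (dlog2 - dlog3)) = 4 * (jac4 * (dlog3 - dlog4))"
    by (simp only: algebra_simps)
  then show ?thesis by (simp only: mult_cancel_left) simp
qed

lemma jac3_dlog_diff: "jac3 * (dlog2 - dlog3) = jac4 * (dlog2 - dlog4)"
  using jacobi_XD by (simp add: jacobi algebra_simps)

lemma dlog2_double: "dlog2 = (dlog2 + dlog3) oo fps_X ^ 2"
proof -
  let ?S = "\<lambda>f::real fps. f oo fps_X ^ 2"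
  have "2 * (dlog2 - fps_const (1/4)) * theta2 ^ 2 = fps_XD (theta2 ^ 2)"
    by (simp add: fps_XD_power theta2_XD) (simp add: power2_eq_square algebra_simps)
  also have "\<dots> = 2 * (?S (dlog2 + dlog3) - fps_const (1/4)) * (2 * (?S theta2 * ?S theta3))"
    by (simp add: theta_half_square fps_XD_mult fps_XD_numeral fps_XD_compose_X_power
        theta2_XD theta3_XD fps_compose_distribs algebra_simps)
  also have "2 * (?S theta2 * ?S theta3) = theta2 ^ 2" by (simp add: theta2_square)
  finally have "(2 * theta2 ^ 2) * (dlog2 - fps_const (1/4)) =
      (2 * theta2 ^ 2) * (?S (dlog2 + dlog3) - fps_const (1/4))" by (simp only: ac_simps)
  then show ?thesis using theta_nonzero by simp
qed

lemma halphen23: "fps_XD dlog2 + fps_XD dlog3 = 4 * dlog2 * dlog3"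
proof -
  let ?S = "\<lambda>f::real fps. f oo fps_X ^ 2"
  let ?Q = "fps_XD dlog3 + dlog3 ^ 2 - 6 * dlog2 * dlog3 + fps_XD dlog2 + dlog2 ^ 2"
  have theta_2_4: "theta \<delta> 2 = dlog \<delta> * theta \<delta> 0"
    "theta \<delta> 4 = (fps_XD (dlog \<delta>) + dlog \<delta> ^ 2) * theta \<delta> 0"
    if "2 * \<delta> \<in> \<int>" for \<delta>
    unfolding dlog_def theta_ratio_4[OF that, unfolded dlog_def, symmetric] by (rule theta_eq_ratio)+
  have "theta2 ^ 2 * (fps_XD dlog2 - 2 * dlog2 ^ 2) = theta2 * theta (1/2) 4 - 3 * theta (1/2) 2 ^ 2"
    unfolding theta_2_4[OF double_in_Ints(2)] by (simp add: power2_eq_square algebra_simps)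
  also have "\<dots> = - 2 * (2 * (?S theta2 * ?S theta3)) * ?S ?Q"
    unfolding theta_half_quartic
    unfolding theta_2_4[OF double_in_Ints(1)] theta_2_4[OF double_in_Ints(2)]
    by (simp add: fps_compose_distribs algebra_simps)
  also have "2 * (?S theta2 * ?S theta3) = theta2 ^ 2" by (simp add: theta2_square)
  finally have "theta2 ^ 2 * (fps_XD dlog2 - 2 * dlog2 ^ 2) = theta2 ^ 2 * (- 2 * ?S ?Q)"
    by (simp only: ac_simps)
  then have "fps_XD dlog2 - 2 * dlog2 ^ 2 = - 2 * ?S ?Q"
    using theta_nonzero by (simp only: mult_cancel_left) simp
  moreover have "fps_XD dlog2 = 2 * ?S (fps_XD dlog2 + fps_XD dlog3)"
    using arg_cong[OF dlog2_double, of fps_XD] by (simp add: fps_XD_compose_X_power)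
  moreover have "dlog2 ^ 2 = ?S ((dlog2 + dlog3) ^ 2)"
    by (subst dlog2_double) (simp add: fps_compose_distribs)
  ultimately have "2 * ?S (fps_XD dlog2 + fps_XD dlog3) - 2 * ?S ((dlog2 + dlog3) ^ 2) = - 2 * ?S ?Q"
    by simp
  then have "?S (2 * (fps_XD dlog2 + fps_XD dlog3) - 2 * (dlog2 + dlog3) ^ 2) = ?S (- 2 * ?Q)"
    by (simp add: fps_compose_distribs)
  then have "2 * (fps_XD dlog2 + fps_XD dlog3) - 2 * (dlog2 + dlog3) ^ 2 = - 2 * ?Q"
    by (rule fps_compose_X_power_inject[OF zero_less_numeral])
  then have "4 * (fps_XD dlog2 + fps_XD dlog3) = 4 * (4 * dlog2 * dlog3)"
    by (simp add: power2_eq_square algebra_simps)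
  then show ?thesis by (simp only: mult_cancel_left) simp
qed

lemma dlog2_uminus_X: "dlog2 oo - fps_X = dlog2"
proof -
  have "dlog2 oo - fps_X = (dlog2 + dlog3) oo fps_X ^ 2 oo - fps_X"
    by (rule arg_cong[OF dlog2_double])
  also have "\<dots> = (dlog2 + dlog3) oo fps_X ^ 2"
    by (rule fps_compose_even_X_power_uminus_X) simp_all
  also have "\<dots> = dlog2" by (rule dlog2_double[symmetric])
  finally show ?thesis .
qed

lemma halphen24: "fps_XD dlog2 + fps_XD dlog4 = 4 * dlog2 * dlog4"
  using arg_cong[OF halphen23, of "\<lambda>f. f oo - fps_X"]
  by (simp add: fps_compose_distribs dlog2_uminus_X dlog4_def flip: fps_XD_compose_uminus_X)

lemma dlog_nth_0: "dlog2 $ 0 = 1/4" "dlog3 $ 0 = 0"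
  using arg_cong[OF theta2_XD, of "\<lambda>f. f $ 0"] arg_cong[OF theta3_XD, of "\<lambda>f. f $ 0"]
  by (simp_all add: theta2_nth_0 theta3_nth_0)

lemma dlog2_XD: "fps_XD dlog2 = 2 * dlog2 ^ 2 - 2 * (dlog2 - dlog3) * (dlog2 - dlog4)"
proof -
  define d23 where "d23 = dlog2 - dlog3"
  define d24 where "d24 = dlog2 - dlog4"
  have cross: "jac3 * d23 = jac4 * d24" using jac3_dlog_diff by (simp add: d23_def d24_def)
  have "d23 $ 0 \<noteq> 0" using dlog_nth_0 by (simp add: d23_def)
  then have "d23 \<noteq> 0" by auto
  then have nonzero: "dlog3 - dlog4 \<noteq> 0" using jacobi_XD jac_nonzero by (auto simp: d23_def)
  have "jac3 * (4 * dlog3 * d23 + fps_XD d23) = jac4 * (4 * dlog4 * d24 + fps_XD d24)"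
    using arg_cong[OF cross, of fps_XD] by (simp add: fps_XD_mult jac_XD algebra_simps)
  then have "jac3 * (d24 * (4 * dlog3 * d23 + fps_XD d23)) =
      (jac4 * d24) * (4 * dlog4 * d24 + fps_XD d24)"
    by (simp only: mult.left_commute[of _ d24] mult.assoc mult.commute[of jac4 d24])
  also have "\<dots> = jac3 * (d23 * (4 * dlog4 * d24 + fps_XD d24))" by (simp flip: cross)
  finally have "d24 * (4 * dlog3 * d23 + fps_XD d23) = d23 * (4 * dlog4 * d24 + fps_XD d24)"
    using jac_nonzero by (simp only: mult_cancel_left) simp
  moreover have derivatives: "fps_XD d23 = 2 * fps_XD dlog2 - 4 * dlog2 * dlog3"
    "fps_XD d24 = 2 * fps_XD dlog2 - 4 * dlog2 * dlog4"
    by (simp_all add: d23_def d24_def fps_XD_diff flip: halphen23 halphen24)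
  ultimately have "(2 * (dlog3 - dlog4)) * fps_XD dlog2 =
      (2 * (dlog3 - dlog4)) * (2 * dlog2 ^ 2 - 2 * d23 * d24)"
    unfolding derivatives by (simp add: d23_def d24_def power2_eq_square algebra_simps)
  then show ?thesis using nonzero unfolding d23_def d24_def by (simp only: mult_cancel_left) simp
qed

text \<open>Both sides satisfy f' = 4 dlog4 f, so their quotient is constant.\<close>

lemma dlog2_minus_dlog3: "4 * (dlog2 - dlog3) = jac4"
proof -
  define g where "g = (dlog2 - dlog3) * inverse jac4"
  have jac4_nth_0: "jac4 $ 0 = 1" by (simp add: jac4_def fps_nth_power_0 theta4_nth_0)
  have factor: "dlog2 - dlog3 = g * jac4" by (simp add: g_def inverse_mult_eq_1 jac4_nth_0 mult.assoc)
  have "fps_XD (dlog2 - dlog3) = 2 * fps_XD dlog2 - 4 * dlog2 * dlog3"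
    by (simp add: fps_XD_diff flip: halphen23)
  also have "\<dots> = 4 * dlog4 * (dlog2 - dlog3)"
    unfolding dlog2_XD by (simp add: power2_eq_square algebra_simps)
  finally have "fps_XD g * jac4 = 0" unfolding factor by (simp add: fps_XD_mult jac_XD algebra_simps)
  then have "g = fps_const (g $ 0)" using jac_nonzero by (simp add: fps_XD_eq_0_iff)
  moreover have "g $ 0 = 1/4" by (simp add: g_def dlog_nth_0 jac4_nth_0)
  ultimately have "g = fps_const (1/4)" by simp
  then show ?thesis by (simp add: factor numeral_fps_const flip: mult.assoc)
qed

lemma dlog2_minus_dlog4: "4 * (dlog2 - dlog4) = jac3"
proof -
  have "jac4 * (4 * (dlog2 - dlog4)) = 4 * (dlog2 - dlog3) * jac3"
    using arg_cong[OF jac3_dlog_diff, of "(*) 4"] by (simp only: ac_simps)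
  then show ?thesis using jac_nonzero unfolding dlog2_minus_dlog3 by (simp only: mult_cancel_left) simp
qed

section \<open>Cumulants of the theta ratios\<close>

definition cumulant4 :: "(nat \<Rightarrow> 'a::comm_ring_1) \<Rightarrow> 'a" where
  "cumulant4 g = g 4 - 3 * g 2 ^ 2"

definition cumulant6 :: "(nat \<Rightarrow> 'a::comm_ring_1) \<Rightarrow> 'a" where
  "cumulant6 g = g 6 - 15 * g 4 * g 2 + 30 * g 2 ^ 3"

lemma cumulant4_theta_ratio:
  assumes "2 * \<delta> \<in> \<int>"
  shows "cumulant4 (theta_ratio \<delta>) = fps_XD (dlog \<delta>) - 2 * dlog \<delta> ^ 2"
  by (simp add: cumulant4_def theta_ratio_4[OF assms] flip: dlog_def)

lemma cumulant6_theta_ratio: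
  assumes "2 * \<delta> \<in> \<int>"
  shows "cumulant6 (theta_ratio \<delta>) =
    fps_XD (cumulant4 (theta_ratio \<delta>)) - 8 * dlog \<delta> * cumulant4 (theta_ratio \<delta>)"
  unfolding cumulant6_def cumulant4_theta_ratio[OF assms] theta_ratio_4[OF assms]
    theta_ratio_6[OF assms] dlog_def[symmetric]
  by (simp add: fps_XD_diff fps_XD_mult fps_XD_numeral power2_eq_square power3_eq_cube algebra_simps)

lemma cumulant4_theta2: "8 * cumulant4 (theta_ratio (1/2)) = - (jac4 * jac3)"
  unfolding cumulant4_theta_ratio[OF double_in_Ints(2)] dlog2_XD
    dlog2_minus_dlog3[symmetric] dlog2_minus_dlog4[symmetric]
  by (simp add: algebra_simps)

lemma cumulant4_theta3: "8 * cumulant4 (theta_ratio 0) = jac2 * jac4"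
proof -
  have jac2: "jac2 = jac3 - jac4" unfolding jacobi by simp
  have dlog3_XD: "fps_XD dlog3 = 4 * dlog2 * dlog3 - fps_XD dlog2"
    using halphen23 by (simp add: algebra_simps)
  show ?thesis
    unfolding cumulant4_theta_ratio[OF double_in_Ints(1)] jac2 dlog3_XD dlog2_XD
      dlog2_minus_dlog3[symmetric] dlog2_minus_dlog4[symmetric]
    by (simp add: algebra_simps power2_eq_square)
qed

lemma eight_cumulant6_theta_ratio:
  assumes "2 * \<delta> \<in> \<int>" "8 * cumulant4 (theta_ratio \<delta>) = f"
  shows "8 * cumulant6 (theta_ratio \<delta>) = fps_XD f - 8 * dlog \<delta> * f"
  unfolding cumulant6_theta_ratio[OF assms(1)] assms(2)[symmetric]
  by (simp add: fps_XD_mult fps_XD_numeral algebra_simps)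

lemma cumulant6_theta2: "8 * cumulant6 (theta_ratio (1/2)) = jac4 * jac3 * (jac4 + jac3)"
proof -
  have "8 * cumulant6 (theta_ratio (1/2)) = jac4 * jac3 * (4 * (dlog2 - dlog3) + 4 * (dlog2 - dlog4))"
    unfolding eight_cumulant6_theta_ratio[OF double_in_Ints(2) cumulant4_theta2]
    by (simp add: fps_XD_uminus fps_XD_mult jac_XD algebra_simps)
  then show ?thesis by (simp only: dlog2_minus_dlog3 dlog2_minus_dlog4)
qed

lemma cumulant6_theta3: "8 * cumulant6 (theta_ratio 0) = jac2 * jac4 * (jac4 - jac2)"
proof -
  have "8 * cumulant6 (theta_ratio 0) =
      jac2 * jac4 * (2 * (4 * (dlog2 - dlog3)) - 4 * (dlog2 - dlog4))"
    unfolding eight_cumulant6_theta_ratio[OF double_in_Ints(1) cumulant4_theta3]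
    by (simp add: fps_XD_mult jac_XD algebra_simps)
  also have "\<dots> = jac2 * jac4 * (jac4 - jac2)"
    unfolding dlog2_minus_dlog3 dlog2_minus_dlog4 jacobi by (simp add: algebra_simps)
  finally show ?thesis .
qed

section \<open>Vanishing coefficients\<close>

lemma jac2_power: "jac2 ^ k = fps_X ^ k * theta2 ^ (4 * k)"
  by (simp add: jac2_def power_mult_distrib flip: power_mult)

lemma jac_product_nth_even_eq_0: "(jac3 * (jac2 * jac4)) $ (2 * n) = 0"
proof (rule fps_odd_nth_even)
  show "jac3 * (jac2 * jac4) oo - fps_X = - (jac3 * (jac2 * jac4))"
    by (simp add: fps_compose_distribs jac_uminus_X mult_ac)
qed simp

lemma jac_double:
  "jac2 ^ (2 * i) * (jac4 * jac3) ^ j * (jac4 + jac3) ^ k =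
    (16 ^ i * 2 ^ k * ((jac2 * jac3) ^ i * jac4 ^ (2 * j) * (jac2 + jac3) ^ k)) oo fps_X ^ 2"
  unfolding power_mult jac2_square jac4_mult_jac3 jac4_add_jac3
  by (simp add: fps_compose_distribs power_mult_distrib del: distrib_left_numeral flip: power_mult)

lemma fps_of_square_nth_double: "f = g oo fps_X ^ 2 \<Longrightarrow> f $ (2 * n) = g $ n"
  for f g :: "'a::comm_ring_1 fps"
  by (simp add: fps_compose_X_power_nth)

lemma jac2_pow4_quartic_nth_eq_0: "(jac2 ^ 4 * (jac4 * jac3)) $ (4 * a + 2) = 0"
proof -
  let ?f = "(jac2 * jac3) ^ 2 * jac4 ^ 2"
  have even: "?f oo - fps_X = ?f"
    by (simp add: fps_compose_distribs jac_uminus_X power_mult_distrib mult_ac)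
  have "(jac2 ^ 4 * (jac4 * jac3)) $ (2 * (2 * a + 1)) = (16 ^ 2 * ?f) $ (2 * a + 1)"
    using jac_double[of 2 1 0] by (intro fps_of_square_nth_double) simp
  then show ?thesis using fps_even_nth_odd[OF even] by (simp add: numeral_fps_const)
qed

text \<open>Up to a scalar this is the difference of the two newforms of weight 14 and level 2, whose
  eigenvalues under U(2) are 64 and -64; hence U(4) acts on it as multiplication by 4096.\<close>

definition newform_diff :: "real fps" where
  "newform_diff = (jac2 * jac3) ^ 2 * jac4 ^ 2 * (jac2 + jac3)"

lemma newform_diff_double:
  "jac2 ^ 4 * (jac4 * jac3 * (jac4 + jac3)) = (512 * newform_diff) oo fps_X ^ 2"
  using jac_double[of 2 1 1] by (simp add: newform_diff_def mult.assoc)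

lemma newform_diff_nth_mult_4: "newform_diff $ (4 * n) = 4096 * newform_diff $ n"
proof -
  define g where "g = jac2 * jac3 * jac4 ^ 4 * (jac2 + jac3)"
  have "newform_diff + (newform_diff oo - fps_X) = jac2 ^ 2 * (jac4 * jac3) ^ 2 * (jac4 + jac3)"
    by (simp add: newform_diff_def fps_compose_distribs jac_uminus_X)
      (simp add: algebra_simps power2_eq_square)
  also have "\<dots> = (32 * g) oo fps_X ^ 2" using jac_double[of 1 2 1] by (simp add: g_def)
  finally have halving: "2 * newform_diff $ (2 * m) = (32 * g) $ m" for m by (rule fps_nth_even_part)
  have "g + (g oo - fps_X) =
      jac2 * jac4 * jac3 * (jac4 ^ 3 * (jac2 + jac3) - jac3 ^ 3 * (jac4 - jac2))"
    by (simp add: g_def fps_compose_distribs jac_uminus_X) (simp add: algebra_simps eval_nat_numeral)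
  then have "g + (g oo - fps_X) = jac2 ^ 4 * (jac4 * jac3 * (jac4 + jac3))"
    unfolding jacobi by (simp add: algebra_simps eval_nat_numeral)
  then have "2 * g $ (2 * n) = (512 * newform_diff) $ n"
    unfolding newform_diff_double by (rule fps_nth_even_part)
  then show ?thesis using halving[of "2 * n"] by (simp add: numeral_fps_const)
qed

lemma newform_diff_nth_power_4_eq_0: "newform_diff $ (4 ^ a) = 0"
proof (induction a)
  case 0
  have factor: "newform_diff = fps_X ^ 2 * (theta2 ^ 8 * jac3 ^ 2 * jac4 ^ 2 * (jac2 + jac3))"
    unfolding newform_diff_def power_mult_distrib[of jac2] jac2_power[of 2] by (simp add: mult_ac)
  show ?case unfolding factor by (simp add: fps_X_power_mult_nth)
next
  case (Suc a)
  then show ?case by (simp add: newform_diff_nth_mult_4)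
qed

lemma jac2_pow4_sextic_nth_eq_0: "(jac2 ^ 4 * (jac4 * jac3 * (jac4 + jac3))) $ (2 * 4 ^ a) = 0"
  using newform_diff_nth_power_4_eq_0[of a]
  by (simp add: newform_diff_double fps_compose_X_power_nth numeral_fps_const)

lemma jac3_pow4_sextic_nth_eq_0: "(jac3 ^ 4 * (jac2 * jac4 * (jac4 - jac2))) $ (2 * 4 ^ a) = 0"
proof -
  let ?f = "jac3 ^ 4 * (jac2 * jac4 * (jac4 - jac2))"
  have "?f + (?f oo - fps_X) = - (jac2 ^ 4 * (jac4 * jac3 * (jac4 + jac3)))"
    by (simp add: fps_compose_distribs jac_uminus_X) (simp add: jacobi algebra_simps eval_nat_numeral)
  also have "\<dots> = (- (512 * newform_diff)) oo fps_X ^ 2"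
    unfolding newform_diff_double by (simp add: fps_compose_distribs)
  finally have "2 * ?f $ (2 * 4 ^ a) = (- (512 * newform_diff)) $ (4 ^ a)" by (rule fps_nth_even_part)
  then show ?thesis using newform_diff_nth_power_4_eq_0[of a] by (simp add: numeral_fps_const)
qed

text \<open>Three modular forms of weight 26: passing to even parts reduces the coefficient of q^12 in the
  first to that of q^6 in the second and of q^3 in the third.\<close>

definition weight26_12 :: "real fps" where
  "weight26_12 = (jac2 * jac3) ^ 5 * jac4 ^ 2 * (jac2 + jac3)"

definition weight26_6 :: "real fps" where
  "weight26_6 = (jac2 * jac3) ^ 3 * jac4 ^ 4 *
    (8 * (jac2 + jac3) ^ 3 - 5 * (jac4 ^ 2 * (jac2 + jac3)))"

definition weight26_3 :: "real fps" where
  "weight26_3 = (jac2 * jac3) ^ 2 * jac4 ^ 6 *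
    (3 * (jac2 + jac3) ^ 3 + 5 * (jac4 ^ 2 * (jac2 + jac3)))"

lemma weight26_12_nth_double: "2 * weight26_12 $ (2 * n) = 8192 * weight26_6 $ n"
proof -
  have "weight26_12 + (weight26_12 oo - fps_X) =
      jac2 ^ 5 * (jac4 * jac3) ^ 2 * (jac3 ^ 3 * (jac2 + jac3) - jac4 ^ 3 * (jac4 - jac2))"
    by (simp add: weight26_12_def fps_compose_distribs jac_uminus_X)
      (simp add: algebra_simps eval_nat_numeral)
  also have "jac3 ^ 3 * (jac2 + jac3) - jac4 ^ 3 * (jac4 - jac2) =
      jac2 * (2 * (jac4 + jac3) ^ 3 - 5 * (jac4 * jac3 * (jac4 + jac3)))"
    unfolding jacobi by (simp add: algebra_simps eval_nat_numeral)
  also have "jac2 ^ 5 * (jac4 * jac3) ^ 2 * \<dots> =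
      2 * (jac2 ^ (2 * 3) * (jac4 * jac3) ^ 2 * (jac4 + jac3) ^ 3)
      - 5 * (jac2 ^ (2 * 3) * (jac4 * jac3) ^ 3 * (jac4 + jac3) ^ 1)"
    by (simp add: algebra_simps eval_nat_numeral)
  also have "\<dots> = (8192 * weight26_6) oo fps_X ^ 2"
    unfolding jac_double weight26_6_def
    by (simp add: fps_compose_distribs algebra_simps flip: power_add)
  finally have "2 * weight26_12 $ (2 * n) = (8192 * weight26_6) $ n" by (rule fps_nth_even_part)
  then show ?thesis by (simp add: numeral_fps_const)
qed

lemma weight26_6_nth_double: "2 * weight26_6 $ (2 * n) = 2048 * weight26_3 $ n"
proof -
  have "weight26_6 + (weight26_6 oo - fps_X) = (jac2 * jac3 * jac4) ^ 3 *
      (jac4 * (8 * (jac2 + jac3) ^ 3 - 5 * (jac4 ^ 2 * (jac2 + jac3)))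
      - jac3 * (8 * (jac4 - jac2) ^ 3 - 5 * (jac3 ^ 2 * (jac4 - jac2))))"
    by (simp add: weight26_6_def fps_compose_distribs jac_uminus_X)
      (simp add: algebra_simps eval_nat_numeral)
  also have "jac4 * (8 * (jac2 + jac3) ^ 3 - 5 * (jac4 ^ 2 * (jac2 + jac3)))
      - jac3 * (8 * (jac4 - jac2) ^ 3 - 5 * (jac3 ^ 2 * (jac4 - jac2))) =
      jac2 * (3 * (jac4 + jac3) ^ 3 + 20 * (jac4 * jac3 * (jac4 + jac3)))"
    unfolding jacobi by (simp add: algebra_simps eval_nat_numeral)
  also have "(jac2 * jac3 * jac4) ^ 3 * \<dots> =
      3 * (jac2 ^ (2 * 2) * (jac4 * jac3) ^ 3 * (jac4 + jac3) ^ 3)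
      + 20 * (jac2 ^ (2 * 2) * (jac4 * jac3) ^ 4 * (jac4 + jac3) ^ 1)"
    by (simp add: algebra_simps eval_nat_numeral)
  also have "\<dots> = (2048 * weight26_3) oo fps_X ^ 2"
    unfolding jac_double weight26_3_def
    by (simp add: fps_compose_distribs algebra_simps flip: power_add)
  finally have "2 * weight26_6 $ (2 * n) = (2048 * weight26_3) $ n" by (rule fps_nth_even_part)
  then show ?thesis by (simp add: numeral_fps_const)
qed

lemma theta_nth_1: "theta2 $ 1 = 0" "theta3 $ 1 = 2" "theta4 $ 1 = - 2"
proof -
  show "theta2 $ 1 = 0" by (rule fps_even_nth_odd[OF theta2_uminus_X]) simp
  show theta3: "theta3 $ 1 = 2"
    by (subst theta_int_double) (simp add: fps_compose_X_power_nth theta2_nth_0)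
  show "theta4 $ 1 = - 2" using theta3 by (simp add: theta4_def fps_compose_uminus')
qed

lemma weight26_3_nth_eq_0: "weight26_3 $ 3 = 0"
proof -
  let ?g = "theta2 ^ 8 * jac3 ^ 2 * jac4 ^ 6 *
    (3 * (jac2 + jac3) ^ 3 + 5 * (jac4 ^ 2 * (jac2 + jac3)))"
  have nth_0_1: "jac2 $ 0 = 0" "jac2 $ Suc 0 = 16" "jac3 $ 0 = 1" "jac3 $ Suc 0 = 8"
    "jac4 $ 0 = 1" "jac4 $ Suc 0 = - 8"
    using theta_nth_1
    by (simp_all add: jac2_def jac3_def jac4_def theta2_nth_0 theta3_nth_0 theta4_nth_0
        eval_nat_numeral)
  have factor: "weight26_3 = fps_X ^ 2 * ?g"
    unfolding weight26_3_def power_mult_distrib[of jac2] jac2_power[of 2] by (simp add: mult_ac)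
  have "weight26_3 $ 3 = ?g $ Suc 0" unfolding factor by (simp add: fps_X_power_mult_nth)
  also have "\<dots> = 0"
    using theta_nth_1 by (simp add: eval_nat_numeral nth_0_1 theta2_nth_0 numeral_fps_const)
  finally show ?thesis .
qed

lemma jac2_pow10_sextic_nth_eq_0: "(jac2 ^ 10 * (jac4 * jac3 * (jac4 + jac3))) $ 24 = 0"
proof -
  have "(jac2 ^ 10 * (jac4 * jac3 * (jac4 + jac3))) $ (2 * 12) = (2 ^ 21 * weight26_12) $ 12"
    using jac_double[of 5 1 1]
    by (intro fps_of_square_nth_double) (simp add: weight26_12_def mult.assoc)
  moreover have "weight26_12 $ 12 = 0"
    using weight26_12_nth_double[of 6] weight26_6_nth_double[of 3] weight26_3_nth_eq_0 by simp
  ultimately show ?thesis by (simp add: numeral_fps_const)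
qed

definition cubic7_quartic :: "real fps" where
  "cubic7_quartic = theta3 ^ 7 * (jac2 * jac4)"

text \<open>Splitting theta3 = A + B by parity gives theta4 = A - B, where A and the cofactor of X in B
  are power series in X^4, so that the power of B determines the exponent of q modulo 4.\<close>

lemma cubic7_quartic_dissection:
  defines "A \<equiv> theta3 oo fps_X ^ 4" and "B \<equiv> fps_X * (theta2 oo fps_X ^ 4)"
  shows "cubic7_quartic = 8 * (jac4 oo fps_X ^ 4) *
    (A ^ 10 * B + 3 * A ^ 9 * B ^ 2 - 8 * A ^ 7 * B ^ 4 - 6 * A ^ 6 * B ^ 5 + 6 * A ^ 5 * B ^ 6
      + 8 * A ^ 4 * B ^ 7 - 3 * A ^ 2 * B ^ 9 - A * B ^ 10)"
proof -
  have theta3: "theta3 = A + B" unfolding A_def B_def by (rule theta_int_double)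
  have "A oo - fps_X = A" "B oo - fps_X = - B"
    by (simp_all add: A_def B_def fps_compose_distribs fps_compose_even_X_power_uminus_X)
  then have theta4: "theta4 = A - B" by (simp add: theta4_def theta3 fps_compose_distribs)
  have jac4_eq: "jac4 = jac3 - jac2" unfolding jacobi by simp
  have jac4_comp: "jac4 oo fps_X ^ 4 = A ^ 4 - B ^ 4"
    unfolding jac4_eq
    by (simp add: A_def B_def jac2_def jac3_def fps_compose_distribs power_mult_distrib)
  have jac2_eq: "jac2 = (A + B) ^ 4 - (A - B) ^ 4"
    using jacobi by (simp add: jac3_def jac4_def theta3 theta4)
  have "cubic7_quartic = (A + B) ^ 7 * (((A + B) ^ 4 - (A - B) ^ 4) * (A - B) ^ 4)"
    by (simp add: cubic7_quartic_def jac2_eq jac4_def theta3 theta4)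
  also have "(A + B) ^ 4 - (A - B) ^ 4 = 8 * A * B * (A ^ 2 + B ^ 2)"
    by (simp add: algebra_simps eval_nat_numeral)
  also have "(A + B) ^ 7 * (8 * A * B * (A ^ 2 + B ^ 2) * (A - B) ^ 4) =
      8 * ((A ^ 2 + B ^ 2) * (A + B) * (A - B)) * (A * B * ((A + B) ^ 3 * ((A + B) * (A - B)) ^ 3))"
    by (simp add: eval_nat_numeral mult_ac)
  also have "(A ^ 2 + B ^ 2) * (A + B) * (A - B) = jac4 oo fps_X ^ 4"
    unfolding jac4_comp by (simp add: algebra_simps eval_nat_numeral)
  also have "(A + B) ^ 3 * ((A + B) * (A - B)) ^ 3 = (A + B) ^ 3 * (A ^ 2 - B ^ 2) ^ 3"
    by (simp add: algebra_simps power2_eq_square)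
  also have "A * B * \<dots> = A ^ 10 * B + 3 * A ^ 9 * B ^ 2 - 8 * A ^ 7 * B ^ 4 - 6 * A ^ 6 * B ^ 5
      + 6 * A ^ 5 * B ^ 6 + 8 * A ^ 4 * B ^ 7 - 3 * A ^ 2 * B ^ 9 - A * B ^ 10"
    by (simp add: algebra_simps eval_nat_numeral)
  finally show ?thesis .
qed

lemma cubic7_quartic_series:
  defines "part \<equiv> \<lambda>j f. fps_X ^ j * (f oo fps_X ^ 4)"
  shows "cubic7_quartic =
    part 1 (8 * jac4 * theta3 ^ 10 * theta2) + part 2 (24 * jac4 * theta3 ^ 9 * theta2 ^ 2)
    - part 4 (64 * jac4 * theta3 ^ 7 * theta2 ^ 4) - part 5 (48 * jac4 * theta3 ^ 6 * theta2 ^ 5)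
    + part 6 (48 * jac4 * theta3 ^ 5 * theta2 ^ 6) + part 7 (64 * jac4 * theta3 ^ 4 * theta2 ^ 7)
    - part 9 (24 * jac4 * theta3 ^ 2 * theta2 ^ 9) - part 10 (8 * jac4 * theta3 * theta2 ^ 10)"
  unfolding cubic7_quartic_dissection part_def
  by (simp add: fps_compose_distribs power_mult_distrib algebra_simps)

lemma fps_X_power_mult_compose_nth_eq_0:
  fixes f :: "'a::comm_ring_1 fps"
  assumes "n mod k \<noteq> j mod k" "k > 0"
  shows "(fps_X ^ j * (f oo fps_X ^ k)) $ n = 0"
  using assms by (auto simp: fps_X_power_mult_nth fps_compose_X_power_nth mod_eq_dvd_iff_nat)

lemma cubic7_quartic_nth_mult_4: "cubic7_quartic $ (4 * n) = - 64 * cubic7_quartic $ n"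
proof -
  have "cubic7_quartic $ (4 * n) =
      - (fps_X ^ 4 * ((64 * jac4 * theta3 ^ 7 * theta2 ^ 4) oo fps_X ^ 4)) $ (4 * n)"
    unfolding cubic7_quartic_series
    by (simp add: fps_X_power_mult_compose_nth_eq_0
        fps_X_power_mult_compose_nth_eq_0[where j = 1, unfolded power_one_right] del: fps_X_mult_nth)
  also have "fps_X ^ 4 * ((64 * jac4 * theta3 ^ 7 * theta2 ^ 4) oo fps_X ^ 4) =
      (64 * cubic7_quartic) oo fps_X ^ 4"
    by (simp add: cubic7_quartic_def jac2_def fps_compose_distribs mult_ac)
  finally show ?thesis by (simp add: fps_compose_X_power_nth numeral_fps_const)
qed

lemma cubic7_quartic_nth_3_mod_8_eq_0: "cubic7_quartic $ (8 * b + 3) = 0"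
proof -
  let ?g = "64 * jac4 * jac3 * theta2 ^ 7"
  have even: "?g oo - fps_X = ?g"
    by (simp add: fps_compose_distribs jac_uminus_X theta2_uminus_X mult_ac)
  have "(8 * b + 3) mod 4 = 3" by presburger
  then have "cubic7_quartic $ (8 * b + 3) = (fps_X ^ 7 * (?g oo fps_X ^ 4)) $ (8 * b + 3)"
    unfolding cubic7_quartic_series
    by (simp add: fps_X_power_mult_compose_nth_eq_0 jac3_def
        fps_X_power_mult_compose_nth_eq_0[where j = 1, unfolded power_one_right] del: fps_X_mult_nth)
  also have "\<dots> = 0"
  proof (cases b)
    case 0
    then show ?thesis by (simp add: fps_X_power_mult_nth)
  next
    case (Suc c)
    then have "8 * b + 3 - 7 = 4 * (2 * c + 1)" by simp
    then show ?thesis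
      using fps_even_nth_odd[OF even, of "2 * c + 1"]
      by (simp only: fps_X_power_mult_nth fps_compose_X_power_nth) simp
  qed
  finally show ?thesis .
qed

lemma cubic7_quartic_nth_eq_0: "cubic7_quartic $ (4 ^ a * (8 * b + 3)) = 0"
proof (induction a)
  case 0
  show ?case by (simp add: cubic7_quartic_nth_3_mod_8_eq_0)
next
  case (Suc a)
  then show ?case
    using cubic7_quartic_nth_mult_4[of "4 ^ a * (8 * b + 3)"] by (simp only: power_Suc mult.assoc)
qed

section \<open>Moments and the design conditions\<close>

definition moment :: "nat \<Rightarrow> (nat \<Rightarrow> real) set \<Rightarrow> (nat \<Rightarrow> nat) \<Rightarrow> real" where
  "moment n X \<alpha> = (\<Sum>x\<in>X. \<Prod>i<n. x i ^ \<alpha> i)"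

definition dual_laplacian :: "nat \<Rightarrow> ((nat \<Rightarrow> nat) \<Rightarrow> real) \<Rightarrow> (nat \<Rightarrow> nat) \<Rightarrow> real" where
  "dual_laplacian n b \<alpha> = (\<Sum>i<n. real (\<alpha> i * (\<alpha> i - 1)) * b (\<alpha>(i := \<alpha> i - 2)))"

lemma finite_multi_idx: "finite (multi_idx n d)"
proof -
  have "multi_idx n d \<subseteq> {\<alpha>. \<forall>i. (i \<in> {..<n} \<longrightarrow> \<alpha> i \<in> {..d}) \<and> (i \<notin> {..<n} \<longrightarrow> \<alpha> i = 0)}"
    by (auto simp: multi_idx_def) (metis finite_lessThan lessThan_iff member_le_sum zero_le)
  then show ?thesis by (rule finite_subset) (intro finite_set_of_finite_funs; simp)
qed

lemma sum_fun_upd: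
  fixes \<alpha> :: "nat \<Rightarrow> nat"
  assumes "i < n"
  shows "(\<Sum>l<n. (\<alpha>(i := v)) l) + \<alpha> i = (\<Sum>l<n. \<alpha> l) + v"
  using assms sum.remove[of "{..<n}" i \<alpha>] sum.remove[of "{..<n}" i "\<alpha>(i := v)"] by simp

lemma multi_idx_lower:
  assumes "\<alpha> \<in> multi_idx n d" "i < n" "c \<le> \<alpha> i"
  shows "\<alpha>(i := \<alpha> i - c) \<in> multi_idx n (d - c)"
  using assms sum_fun_upd[of i n \<alpha> "\<alpha> i - c"] by (auto simp: multi_idx_def)

lemma multi_idx_raise:
  assumes "\<beta> \<in> multi_idx n d" "i < n"
  shows "\<beta>(i := \<beta> i + c) \<in> multi_idx n (d + c)"
  using assms sum_fun_upd[of i n \<beta> "\<beta> i + c"] by (auto simp: multi_idx_def)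

lemma sum_multi_idx_shift:
  assumes "i < n" "2 \<le> k"
  shows "(\<Sum>\<alpha>\<in>multi_idx n k. c \<alpha> * (real (\<alpha> i * (\<alpha> i - 1)) * b (\<alpha>(i := \<alpha> i - 2)))) =
    (\<Sum>\<beta>\<in>multi_idx n (k - 2). b \<beta> * (real ((\<beta> i + 2) * (\<beta> i + 1)) * c (\<beta>(i := \<beta> i + 2))))"
  (is "sum ?f _ = sum ?g _")
proof -
  have "sum ?f (multi_idx n k) = sum ?f {\<alpha> \<in> multi_idx n k. 2 \<le> \<alpha> i}"
  proof (rule sum.mono_neutral_right[OF finite_multi_idx])
    show "\<forall>\<alpha>\<in>multi_idx n k - {\<alpha> \<in> multi_idx n k. 2 \<le> \<alpha> i}. ?f \<alpha> = 0"
    proof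
      fix \<alpha> assume "\<alpha> \<in> multi_idx n k - {\<alpha> \<in> multi_idx n k. 2 \<le> \<alpha> i}"
      then have "\<alpha> i = 0 \<or> \<alpha> i = 1" by auto
      then show "?f \<alpha> = 0" by auto
    qed
  qed auto
  also have "\<dots> = sum ?g (multi_idx n (k - 2))"
  proof (rule sum.reindex_bij_witness[where i = "\<lambda>\<beta>. \<beta>(i := \<beta> i + 2)" and j = "\<lambda>\<alpha>. \<alpha>(i := \<alpha> i - 2)"])
    fix \<alpha> assume \<alpha>: "\<alpha> \<in> {\<alpha> \<in> multi_idx n k. 2 \<le> \<alpha> i}"
    then show "\<alpha>(i := \<alpha> i - 2) \<in> multi_idx n (k - 2)"
      using multi_idx_lower[of \<alpha> n k i 2] assms(1) by simp
    have "2 \<le> \<alpha> i" using \<alpha> by simp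
    then have "\<alpha> i - 2 + 2 = \<alpha> i" "\<alpha> i - 2 + 1 = \<alpha> i - 1" by auto
    then show "?g (\<alpha>(i := \<alpha> i - 2)) = ?f \<alpha>"
      by (simp only: fun_upd_same fun_upd_upd fun_upd_triv ac_simps)
  next
    fix \<beta> assume "\<beta> \<in> multi_idx n (k - 2)"
    then show "\<beta>(i := \<beta> i + 2) \<in> {\<alpha> \<in> multi_idx n k. 2 \<le> \<alpha> i}"
      using multi_idx_raise[of \<beta> n "k - 2" i 2, unfolded le_add_diff_inverse2[OF assms(2)]] assms(1)
      by simp
  qed (auto simp: fun_eq_iff)
  finally show ?thesis .
qed

text \<open>A harmonic polynomial is orthogonal to the image of the transposed Laplacian.\<close>

lemma design_condI:
  assumes "\<And>\<alpha>. \<alpha> \<in> multi_idx n k \<Longrightarrow> moment n X \<alpha> = dual_laplacian n b \<alpha>"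
  shows "design_cond n X k"
  unfolding design_cond_def
proof (intro allI impI)
  fix c assume harmonic: "harmonic_coeffs n k c"
  have "(\<Sum>x\<in>X. hpoly_eval n k c x) = (\<Sum>\<alpha>\<in>multi_idx n k. c \<alpha> * moment n X \<alpha>)"
    unfolding hpoly_eval_def moment_def by (subst sum.swap) (simp add: sum_distrib_left)
  also have "\<dots> = (\<Sum>i<n. \<Sum>\<alpha>\<in>multi_idx n k.
      c \<alpha> * (real (\<alpha> i * (\<alpha> i - 1)) * b (\<alpha>(i := \<alpha> i - 2))))"
    by (subst sum.swap) (simp add: assms dual_laplacian_def sum_distrib_left)
  also have "\<dots> = (\<Sum>i<n. \<Sum>\<beta>\<in>multi_idx n (k - 2).
      b \<beta> * (real ((\<beta> i + 2) * (\<beta> i + 1)) * c (\<beta>(i := \<beta> i + 2))))"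
    using harmonic unfolding harmonic_coeffs_def
    by (intro sum.cong[OF refl] sum_multi_idx_shift) auto
  also have "\<dots> = (\<Sum>\<beta>\<in>multi_idx n (k - 2).
      b \<beta> * (\<Sum>i<n. real ((\<beta> i + 2) * (\<beta> i + 1)) * c (\<beta>(i := \<beta> i + 2))))"
    by (subst sum.swap) (simp only: sum_distrib_left)
  also have "\<dots> = 0" using harmonic by (intro sum.neutral) (simp add: harmonic_coeffs_def)
  finally show "(\<Sum>x\<in>X. hpoly_eval n k c x) = 0" .
qed

definition even_idx :: "nat \<Rightarrow> (nat \<Rightarrow> nat) \<Rightarrow> bool" where
  "even_idx n \<alpha> \<longleftrightarrow> (\<forall>i<n. even (\<alpha> i))"

lemma design_cond_evenI:
  assumes odd: "\<And>\<alpha>. \<not> even_idx n \<alpha> \<Longrightarrow> moment n X \<alpha> = 0"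
    and even: "\<And>\<alpha>. \<alpha> \<in> multi_idx n k \<Longrightarrow> even_idx n \<alpha> \<Longrightarrow>
      moment n X \<alpha> = dual_laplacian n b \<alpha>"
  shows "design_cond n X k"
proof (rule design_condI[where b = "\<lambda>\<beta>. if even_idx n \<beta> then b \<beta> else 0"])
  fix \<alpha> assume idx: "\<alpha> \<in> multi_idx n k"
  have "real (\<alpha> i * (\<alpha> i - 1)) * (if even_idx n (\<alpha>(i := \<alpha> i - 2)) then v else 0) =
      (if even_idx n \<alpha> then real (\<alpha> i * (\<alpha> i - 1)) * v else 0)" for i v
  proof (cases "2 \<le> \<alpha> i")
    case True
    then have "even_idx n (\<alpha>(i := \<alpha> i - 2)) \<longleftrightarrow> even_idx n \<alpha>" by (auto simp: even_idx_def)
    then show ?thesis by simp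
  next
    case False
    then have "\<alpha> i = 0 \<or> \<alpha> i = 1" by auto
    then show ?thesis by auto
  qed
  then have "dual_laplacian n (\<lambda>\<beta>. if even_idx n \<beta> then b \<beta> else 0) \<alpha> =
      (if even_idx n \<alpha> then dual_laplacian n b \<alpha> else 0)"
    by (simp add: dual_laplacian_def)
  then show "moment n X \<alpha> = dual_laplacian n (\<lambda>\<beta>. if even_idx n \<beta> then b \<beta> else 0) \<alpha>"
    using odd even[OF idx] by simp
qed

lemma even_multi_idx_lower:
  assumes "\<alpha> \<in> multi_idx n (d + 2)" "even_idx n \<alpha>"
  obtains i \<beta> where "i < n" "\<beta> \<in> multi_idx n d" "even_idx n \<beta>" "\<alpha> = \<beta>(i := \<beta> i + 2)"
proof -
  have "(\<Sum>i<n. \<alpha> i) \<noteq> 0" using assms(1) by (simp add: multi_idx_def)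
  then obtain i where "i < n" "\<alpha> i \<noteq> 0" by auto
  then have "2 \<le> \<alpha> i" using assms(2) by (cases "\<alpha> i = 1") (auto simp: even_idx_def)
  then have "\<alpha>(i := \<alpha> i - 2) \<in> multi_idx n d" "\<alpha> = (\<alpha>(i := \<alpha> i - 2))(i := (\<alpha>(i := \<alpha> i - 2)) i + 2)"
    using multi_idx_lower[OF assms(1) \<open>i < n\<close>, of 2] by (auto simp: fun_eq_iff)
  moreover have "even_idx n (\<alpha>(i := \<alpha> i - 2))" using assms(2) by (simp add: even_idx_def)
  ultimately show thesis using \<open>i < n\<close> that by blast
qed

lemma multi_idx_0: "\<alpha> \<in> multi_idx n 0 \<Longrightarrow> \<alpha> = (\<lambda>_. 0)"
  by (auto simp: multi_idx_def fun_eq_iff) (meson lessThan_iff not_le)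

lemma even_multi_idx_2_cases:
  assumes "\<alpha> \<in> multi_idx n 2" "even_idx n \<alpha>"
  obtains i where "i < n" "\<alpha> = (\<lambda>_. 0)(i := 2)"
proof -
  have "\<alpha> \<in> multi_idx n (0 + 2)" using assms(1) by (simp only: add_0)
  then obtain i \<beta> where "i < n" "\<beta> \<in> multi_idx n 0" "\<alpha> = \<beta>(i := \<beta> i + 2)"
    using assms(2) by (rule even_multi_idx_lower)
  then show thesis using multi_idx_0 that by fastforce
qed

lemma even_multi_idx_4_cases:
  assumes "\<alpha> \<in> multi_idx n 4" "even_idx n \<alpha>"
  obtains (four) i where "i < n" "\<alpha> = (\<lambda>_. 0)(i := 4)"
  | (two_two) i j where "i < n" "j < n" "i \<noteq> j" "\<alpha> = (\<lambda>_. 0)(i := 2, j := 2)"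
proof -
  have "\<alpha> \<in> multi_idx n (2 + 2)" using assms(1) by simp
  then obtain i \<beta> where lower: "i < n" "\<beta> \<in> multi_idx n 2" "even_idx n \<beta>" "\<alpha> = \<beta>(i := \<beta> i + 2)"
    using assms(2) by (rule even_multi_idx_lower)
  obtain j where two: "j < n" "\<beta> = (\<lambda>_. 0)(j := 2)" using lower(2,3) by (rule even_multi_idx_2_cases)
  show thesis
  proof (cases "i = j")
    case True
    then show ?thesis using lower two by (intro four[of i]) auto
  next
    case False
    then show ?thesis using lower two by (intro two_two[of j i]) auto
  qed
qed

lemma even_multi_idx_6_cases:
  assumes "\<alpha> \<in> multi_idx n 6" "even_idx n \<alpha>"
  obtains (six) i where "i < n" "\<alpha> = (\<lambda>_. 0)(i := 6)"
  | (four_two) i j where "i < n" "j < n" "i \<noteq> j" "\<alpha> = (\<lambda>_. 0)(i := 4, j := 2)"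
  | (two_two_two) i j k where "i < n" "j < n" "k < n" "i \<noteq> j" "i \<noteq> k" "j \<noteq> k"
      "\<alpha> = (\<lambda>_. 0)(i := 2, j := 2, k := 2)"
proof -
  have "\<alpha> \<in> multi_idx n (4 + 2)" using assms(1) by simp
  then obtain i \<beta> where lower: "i < n" "\<beta> \<in> multi_idx n 4" "even_idx n \<beta>" "\<alpha> = \<beta>(i := \<beta> i + 2)"
    using assms(2) by (rule even_multi_idx_lower)
  from lower(2,3) show thesis
  proof (cases rule: even_multi_idx_4_cases)
    case (four j)
    show ?thesis
    proof (cases "i = j")
      case True
      then show ?thesis using lower four by (intro six[of i]) auto
    next
      case False
      then show ?thesis using lower four by (intro four_two[of j i]) auto
    qed
  next
    case (two_two j k)
    consider (eq_j) "i = j" | (eq_k) "i = k" | (distinct) "i \<noteq> j" "i \<noteq> k" by blast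
    then show ?thesis
    proof cases
      case eq_j
      then show ?thesis using lower two_two by (intro four_two[of i k]) auto
    next
      case eq_k
      then show ?thesis using lower two_two by (intro four_two[of i j]) auto
    next
      case distinct
      then show ?thesis using lower two_two by (intro two_two_two[of j k i]) auto
    qed
  qed
qed

lemma dual_laplacian_support:
  assumes "S \<subseteq> {..<n}" "\<And>i. i \<notin> S \<Longrightarrow> \<alpha> i = 0"
  shows "dual_laplacian n b \<alpha> = (\<Sum>i\<in>S. real (\<alpha> i * (\<alpha> i - 1)) * b (\<alpha>(i := \<alpha> i - 2)))"
  unfolding dual_laplacian_def using assms by (intro sum.mono_neutral_right) auto

locale product_moments = additive \<phi>
  for \<phi> :: "'a::comm_ring_1 \<Rightarrow> real" +
  fixes n :: nat and X :: "(nat \<Rightarrow> real) set" and g :: "nat \<Rightarrow> 'a"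
  assumes moment_eq: "moment n X \<alpha> = \<phi> (\<Prod>i<n. g (\<alpha> i))"
    and g_0: "g 0 = 1"
    and g_odd: "odd j \<Longrightarrow> g j = 0"
begin

lemma numeral_mult: "\<phi> (numeral k * a) = numeral k * \<phi> a"
proof -
  have "\<phi> (of_nat m * a) = of_nat m * \<phi> a" for m
    by (induction m) (simp_all add: zero add distrib_right)
  from this[of "numeral k"] show ?thesis by simp
qed

lemma moment_not_even: "\<not> even_idx n \<alpha> \<Longrightarrow> moment n X \<alpha> = 0"
  unfolding moment_eq even_idx_def using g_odd by (subst prod_zero) (auto simp: zero)

lemma moment_support:
  assumes "S \<subseteq> {..<n}" "\<And>i. i \<notin> S \<Longrightarrow> \<alpha> i = 0"
  shows "moment n X \<alpha> = \<phi> (\<Prod>i\<in>S. g (\<alpha> i))"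
  unfolding moment_eq using assms g_0 by (intro arg_cong[of _ _ \<phi>] prod.mono_neutral_right) auto

lemma design_cond_2: "design_cond n X 2"
proof (rule design_cond_evenI[where b = "\<lambda>_. \<phi> (g 2) / 2"])
  fix \<alpha> assume "\<alpha> \<in> multi_idx n 2" "even_idx n \<alpha>"
  then obtain i where two: "i < n" "\<alpha> = (\<lambda>_. 0)(i := 2)" by (rule even_multi_idx_2_cases)
  then have "moment n X \<alpha> = \<phi> (g 2)" by (subst moment_support[of "{i}"]) auto
  moreover have "dual_laplacian n (\<lambda>_. \<phi> (g 2) / 2) \<alpha> = \<phi> (g 2)"
    using two by (subst dual_laplacian_support[of "{i}"]) auto
  ultimately show "moment n X \<alpha> = dual_laplacian n (\<lambda>_. \<phi> (g 2) / 2) \<alpha>" by simp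
qed (rule moment_not_even)

text \<open>The exponential generating function of the moments of degree 4 is a combination of
  (sum t_i^2)^2 and the fourth cumulant times sum t_i^4; that of degree 6 is a multiple of sum t_i^2
  plus the sixth cumulant times sum t_i^6, and sum t_i^6 is itself a multiple if n = 2. The
  witnesses b below are the coefficients of the quotients by sum t_i^2.\<close>

lemma design_cond_4:
  assumes "\<phi> (cumulant4 g) = 0"
  shows "design_cond n X 4"
proof (rule design_cond_evenI[where b = "\<lambda>_. \<phi> (g 2 ^ 2) / 4"])
  have g_4: "\<phi> (g 4) = 3 * \<phi> (g 2 ^ 2)" using assms by (simp add: cumulant4_def diff numeral_mult)
  fix \<alpha> assume "\<alpha> \<in> multi_idx n 4" "even_idx n \<alpha>"
  then show "moment n X \<alpha> = dual_laplacian n (\<lambda>_. \<phi> (g 2 ^ 2) / 4) \<alpha>"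
  proof (cases rule: even_multi_idx_4_cases)
    case (four i)
    then have "moment n X \<alpha> = \<phi> (g 4)" by (subst moment_support[of "{i}"]) auto
    moreover have "dual_laplacian n (\<lambda>_. \<phi> (g 2 ^ 2) / 4) \<alpha> = 3 * \<phi> (g 2 ^ 2)"
      using four by (subst dual_laplacian_support[of "{i}"]) auto
    ultimately show ?thesis by (simp add: g_4)
  next
    case (two_two i j)
    then have "moment n X \<alpha> = \<phi> (g 2 ^ 2)"
      by (subst moment_support[of "{i, j}"]) (auto simp: power2_eq_square)
    moreover have "dual_laplacian n (\<lambda>_. \<phi> (g 2 ^ 2) / 4) \<alpha> = \<phi> (g 2 ^ 2)"
      using two_two by (subst dual_laplacian_support[of "{i, j}"]) auto
    ultimately show ?thesis by simp
  qed
qed (rule moment_not_even)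

lemma design_cond_6:
  assumes "n \<le> 2 \<or> \<phi> (cumulant6 g) = 0"
  shows "design_cond n X 6"
proof -
  define p where "p = \<phi> (g 6) / 30"
  define r where "r = (\<phi> (g 4 * g 2) - 2 * p) / 12"
  define b where "b = (\<lambda>\<beta>::nat \<Rightarrow> nat. if \<exists>l<n. \<beta> l = 4 then p else r)"
  have g_6: "\<phi> (g 6) = 30 * p" and g_42: "\<phi> (g 4 * g 2) = 12 * r + 2 * p"
    by (simp_all add: p_def r_def field_simps)
  have g_222: "\<phi> (g 2 ^ 3) = 6 * r" if "\<not> n \<le> 2"
    using assms that g_6 g_42 by (simp add: cumulant6_def diff add numeral_mult mult.assoc)
  show ?thesis
  proof (rule design_cond_evenI[where b = b])
    fix \<alpha> assume "\<alpha> \<in> multi_idx n 6" "even_idx n \<alpha>"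
    then show "moment n X \<alpha> = dual_laplacian n b \<alpha>"
    proof (cases rule: even_multi_idx_6_cases)
      case (six i)
      then have "dual_laplacian n b \<alpha> = 30 * p"
        by (subst dual_laplacian_support[of "{i}"]) (auto simp: b_def)
      moreover have "moment n X \<alpha> = \<phi> (g 6)" using six by (subst moment_support[of "{i}"]) auto
      ultimately show ?thesis by (simp add: g_6)
    next
      case (four_two i j)
      then have "dual_laplacian n b \<alpha> = 12 * r + 2 * p"
        by (subst dual_laplacian_support[of "{i, j}"]) (auto simp: b_def)
      moreover have "moment n X \<alpha> = \<phi> (g 4 * g 2)"
        using four_two by (subst moment_support[of "{i, j}"]) auto
      ultimately show ?thesis by (simp add: g_42)
    next
      case (two_two_two i j k)
      then have "dual_laplacian n b \<alpha> = 6 * r"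
        by (subst dual_laplacian_support[of "{i, j, k}"]) (auto simp: b_def)
      moreover have "\<not> n \<le> 2" using two_two_two by auto
      moreover have "moment n X \<alpha> = \<phi> (g 2 ^ 3)"
        using two_two_two
        by (subst moment_support[of "{i, j, k}"]) (auto simp: power3_eq_cube mult.assoc)
      ultimately show ?thesis using g_222 by simp
    qed
  qed (rule moment_not_even)
qed

end

section \<open>Sums of four squares\<close>

definition four_squares :: "int \<Rightarrow> bool" where
  "four_squares n \<longleftrightarrow> (\<exists>a. n = (\<Sum>i<4::nat. (a i)\<^sup>2))"

lemma sum_lessThan_4: "(\<Sum>i<4::nat. f i) = f 0 + f 1 + f 2 + f 3"
  by (simp add: numeral_eq_Suc)

lemma four_squaresI: "four_squares (a\<^sup>2 + b\<^sup>2 + c\<^sup>2 + d\<^sup>2)"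
  unfolding four_squares_def by (rule exI[of _ "\<lambda>i. [a, b, c, d] ! i"]) (simp add: sum_lessThan_4)

lemma euler_four_square:
  fixes a b c d w x y z :: "'a::comm_ring_1"
  shows "(a\<^sup>2 + b\<^sup>2 + c\<^sup>2 + d\<^sup>2) * (w\<^sup>2 + x\<^sup>2 + y\<^sup>2 + z\<^sup>2) =
    (a * w + b * x + c * y + d * z)\<^sup>2 + (a * x - b * w + c * z - d * y)\<^sup>2 +
    (a * y - b * z - c * w + d * x)\<^sup>2 + (a * z + b * y - c * x - d * w)\<^sup>2"
  by (simp add: power2_eq_square algebra_simps)

lemma four_squares_mult:
  assumes "four_squares m" "four_squares n"
  shows "four_squares (m * n)"
proof -
  obtain a w where "m = (\<Sum>i<4::nat. (a i)\<^sup>2)" "n = (\<Sum>i<4::nat. (w i)\<^sup>2)"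
    using assms unfolding four_squares_def by blast
  then show ?thesis unfolding sum_lessThan_4 by (simp only: euler_four_square four_squaresI)
qed

lemma ex_balanced_residue:
  fixes x m :: int
  assumes "m > 0"
  shows "\<exists>y. m dvd x - y \<and> \<bar>2 * y\<bar> \<le> m"
proof -
  define h where "h = m div 2"
  define t where "t = (x + h) mod m"
  have "x - (t - h) = (x + h) - (x + h) mod m" by (simp add: t_def)
  then have "m dvd x - (t - h)" by (simp only: dvd_minus_mod)
  moreover have "0 \<le> t" "t < m" using assms by (simp_all add: t_def)
  moreover have "2 * h \<le> m" "m \<le> 2 * h + 1" by (simp_all add: h_def)
  ultimately show ?thesis by (intro exI[of _ "t - h"]) simp
qed

lemma four_squares_congruent_quotient:
  fixes a w :: "nat \<Rightarrow> int"
  assumes "m \<noteq> 0" "(\<Sum>i<4. (a i)\<^sup>2) = m * p" "(\<Sum>i<4. (w i)\<^sup>2) = m * r" "\<And>i. m dvd a i - w i"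
  shows "four_squares (r * p)"
proof -
  define q where "q i = (a i - w i) div m" for i
  have a_eq: "a i = w i + m * q i" for i using assms(4)[of i] by (simp add: q_def)
  let ?k0 = "r + (q 0 * w 0 + q 1 * w 1 + q 2 * w 2 + q 3 * w 3)"
  let ?k1 = "q 0 * w 1 - q 1 * w 0 + q 2 * w 3 - q 3 * w 2"
  let ?k2 = "q 0 * w 2 - q 1 * w 3 - q 2 * w 0 + q 3 * w 1"
  let ?k3 = "q 0 * w 3 + q 1 * w 2 - q 2 * w 1 - q 3 * w 0"
  have "a 0 * w 0 + a 1 * w 1 + a 2 * w 2 + a 3 * w 3 =
      (\<Sum>i<4. (w i)\<^sup>2) + m * (q 0 * w 0 + q 1 * w 1 + q 2 * w 2 + q 3 * w 3)"
    by (simp add: sum_lessThan_4 a_eq power2_eq_square algebra_simps)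
  then have component0: "a 0 * w 0 + a 1 * w 1 + a 2 * w 2 + a 3 * w 3 = m * ?k0"
    by (simp add: assms(3) distrib_left)
  have components: "a 0 * w 1 - a 1 * w 0 + a 2 * w 3 - a 3 * w 2 = m * ?k1"
    "a 0 * w 2 - a 1 * w 3 - a 2 * w 0 + a 3 * w 1 = m * ?k2"
    "a 0 * w 3 + a 1 * w 2 - a 2 * w 1 - a 3 * w 0 = m * ?k3"
    by (simp_all add: a_eq algebra_simps)
  have "m\<^sup>2 * (r * p) = (\<Sum>i<4. (a i)\<^sup>2) * (\<Sum>i<4. (w i)\<^sup>2)"
    unfolding assms(2,3) by (simp add: power2_eq_square)
  also have "\<dots> = m\<^sup>2 * (?k0\<^sup>2 + ?k1\<^sup>2 + ?k2\<^sup>2 + ?k3\<^sup>2)"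
    unfolding sum_lessThan_4 euler_four_square component0 components
      power_mult_distrib distrib_left[of "m\<^sup>2"] ..
  finally have "r * p = ?k0\<^sup>2 + ?k1\<^sup>2 + ?k2\<^sup>2 + ?k3\<^sup>2" using assms(1) by simp
  then show ?thesis by (simp only: four_squaresI)
qed

lemma sum_squares_cong_mod_square:
  fixes a w :: "'b \<Rightarrow> int"
  assumes "\<And>i. i \<in> I \<Longrightarrow> m dvd a i - w i" "\<And>i. i \<in> I \<Longrightarrow> m dvd 2 * w i"
  shows "m\<^sup>2 dvd (\<Sum>i\<in>I. (a i)\<^sup>2) - (\<Sum>i\<in>I. (w i)\<^sup>2)"
  unfolding sum_subtractf[symmetric]
proof (rule dvd_sum)
  fix i assume "i \<in> I"
  then have dvd: "m dvd a i - w i" "m dvd 2 * w i" using assms by auto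
  have "m * m dvd (a i - w i) * ((a i - w i) + 2 * w i)"
    using dvd(1) dvd_add[OF dvd] by (rule mult_dvd_mono)
  then show "m\<^sup>2 dvd (a i)\<^sup>2 - (w i)\<^sup>2" by (simp add: power2_eq_square algebra_simps)
qed

lemma balanced_sum_squares:
  fixes m r :: int and w :: "nat \<Rightarrow> int"
  assumes "0 < m" "\<And>i. \<bar>2 * w i\<bar> \<le> m" and sum_w: "(\<Sum>i<4. (w i)\<^sup>2) = m * r"
  shows "0 \<le> r" "r \<le> m" "r = 0 \<or> r = m \<Longrightarrow> i < 4 \<Longrightarrow> m dvd 2 * w i"
proof -
  have square_le: "4 * (w i)\<^sup>2 \<le> m\<^sup>2" for i
    using power_mono[OF assms(2), of i 2] by (simp add: power_mult_distrib)
  have "0 \<le> m * r" unfolding sum_w[symmetric] by (intro sum_nonneg) simp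
  then show "0 \<le> r" using assms(1) by (simp add: zero_le_mult_iff)
  have "4 * (m * r) = (\<Sum>i<4. 4 * (w i)\<^sup>2)" by (simp flip: sum_w add: sum_distrib_left)
  also have "\<dots> \<le> (\<Sum>i<4::nat. m\<^sup>2)" by (rule sum_mono) (rule square_le)
  finally show "r \<le> m" using assms(1) by (simp add: power2_eq_square)
  assume "r = 0 \<or> r = m" "i < 4"
  then show "m dvd 2 * w i"
  proof (elim disjE)
    assume "r = 0"
    then show ?thesis using sum_w \<open>i < 4\<close> by (simp add: sum_nonneg_eq_0_iff)
  next
    assume "r = m"
    then have "(\<Sum>i<4. m\<^sup>2 - 4 * (w i)\<^sup>2) = 0"
      using sum_w by (simp add: sum_subtractf power2_eq_square flip: sum_distrib_left)
    then have "(2 * w i)\<^sup>2 = m\<^sup>2"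
      using \<open>i < 4\<close> square_le by (simp add: sum_nonneg_eq_0_iff power_mult_distrib)
    then show ?thesis by (metis dvd_refl power2_eq_iff dvd_minus_iff)
  qed
qed

lemma four_squares_descent:
  fixes m p :: int
  assumes "prime p" "1 < m" "m < p" "four_squares (m * p)"
  obtains r where "0 < r" "r < m" "four_squares (r * p)"
proof -
  obtain a :: "nat \<Rightarrow> int" where sum_a: "m * p = (\<Sum>i<4. (a i)\<^sup>2)"
    using assms(4) unfolding four_squares_def by blast
  have "\<forall>i. \<exists>y. m dvd a i - y \<and> \<bar>2 * y\<bar> \<le> m" using ex_balanced_residue[of m] assms(2) by simp
  then obtain w where cong: "\<And>i. m dvd a i - w i" and small: "\<And>i. \<bar>2 * w i\<bar> \<le> m" by metis
  have "m dvd (\<Sum>i<4. (a i)\<^sup>2 - (w i)\<^sup>2)"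
    by (rule dvd_sum) (simp add: power2_eq_square square_diff_square_factored cong)
  then have "m dvd (\<Sum>i<4. (w i)\<^sup>2)" by (simp add: sum_subtractf dvd_diff_right_iff flip: sum_a)
  then obtain r where sum_w: "(\<Sum>i<4. (w i)\<^sup>2) = m * r" by (elim dvdE)
  note bounds = balanced_sum_squares[OF _ small sum_w]
  have "r \<noteq> 0 \<and> r \<noteq> m"
  proof (rule ccontr)
    assume "\<not> (r \<noteq> 0 \<and> r \<noteq> m)"
    then have extreme: "r = 0 \<or> r = m" by blast
    have "m\<^sup>2 dvd (\<Sum>i<4. (a i)\<^sup>2) - (\<Sum>i<4. (w i)\<^sup>2)"
      by (rule sum_squares_cong_mod_square) (use assms(2) cong bounds(3)[OF _ extreme] in auto)
    then have "m * m dvd m * (p - r)"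
      unfolding sum_w sum_a[symmetric] by (simp add: power2_eq_square right_diff_distrib)
    then have "m dvd p" using assms(2) extreme by (auto simp: dvd_diff_left_iff)
    then show False
      using assms(1-3) by (metis prime_int_iff less_irrefl less_trans zero_less_one order_less_imp_le)
  qed
  moreover have "four_squares (r * p)"
    by (rule four_squares_congruent_quotient[OF _ sum_a[symmetric] sum_w cong]) (use assms(2) in simp)
  ultimately show thesis using bounds(1,2) assms(2) by (intro that[of r]) auto
qed

lemma four_squares_prime_multiple:
  fixes m p :: int
  assumes "prime p"
  shows "0 < m \<Longrightarrow> m < p \<Longrightarrow> four_squares (m * p) \<Longrightarrow> four_squares p"
proof (induction "nat m" arbitrary: m rule: less_induct)
  case less
  show ?case
  proof (cases "m = 1")
    case True
    then show ?thesis using less.prems by simp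
  next
    case False
    then have "1 < m" using less.prems(1) by simp
    then obtain r where "0 < r" "r < m" "four_squares (r * p)"
      using four_squares_descent[OF assms _ less.prems(2,3)] by blast
    then show ?thesis using less.hyps[of r] less.prems by simp
  qed
qed

lemma prime_dvd_diff_squares_imp_eq:
  fixes p h a b :: int
  assumes "prime p" "p = 2 * h + 1" "a \<in> {0..h}" "b \<in> {0..h}" "p dvd a\<^sup>2 - b\<^sup>2"
  shows "a = b"
proof -
  have "p dvd (a - b) * (a + b)" using assms(5) by (simp add: power2_eq_square algebra_simps)
  then consider (diff) "p dvd a - b" | (sum) "p dvd a + b"
    using assms(1) by (auto simp: prime_dvd_mult_iff)
  then show ?thesis
  proof cases
    case diff
    then have "p dvd b - a" by (simp add: dvd_diff_commute)
    with diff show ?thesis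
      using assms(2-4) zdvd_imp_le[of p "a - b"] zdvd_imp_le[of p "b - a"] by fastforce
  next
    case sum
    then show ?thesis using assms(2-4) zdvd_imp_le[of p "a + b"] by fastforce
  qed
qed

text \<open>The residues of a^2 and of -1 - b^2 are too many to be disjoint.\<close>

lemma prime_dvd_sum_squares_plus_1:
  fixes p h :: int
  assumes "prime p" "p = 2 * h + 1"
  obtains a b where "a \<in> {0..h}" "b \<in> {0..h}" "p dvd a\<^sup>2 + b\<^sup>2 + 1"
proof -
  let ?f = "\<lambda>a. a\<^sup>2 mod p" and ?g = "\<lambda>b. (- 1 - b\<^sup>2) mod p"
  have "p > 1" using assms(1) by (rule prime_gt_1_int)
  have inj_f: "inj_on ?f {0..h}"
    using prime_dvd_diff_squares_imp_eq[OF assms] by (auto intro!: inj_onI simp: mod_eq_dvd_iff)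
  have inj_g: "inj_on ?g {0..h}"
  proof (rule inj_onI)
    fix a b assume range: "a \<in> {0..h}" "b \<in> {0..h}" and "?g a = ?g b"
    then have "p dvd b\<^sup>2 - a\<^sup>2" by (simp add: mod_eq_dvd_iff)
    then show "a = b" using prime_dvd_diff_squares_imp_eq[OF assms range(2,1)] by simp
  qed
  have "?f ` {0..h} \<inter> ?g ` {0..h} \<noteq> {}"
  proof
    assume "?f ` {0..h} \<inter> ?g ` {0..h} = {}"
    then have "card (?f ` {0..h} \<union> ?g ` {0..h}) = 2 * nat (h + 1)"
      using inj_f inj_g by (subst card_Un_disjoint) (auto simp: card_image)
    moreover have "card (?f ` {0..h} \<union> ?g ` {0..h}) \<le> card {0..<p}"
      using \<open>p > 1\<close> by (intro card_mono) auto
    ultimately show False using assms(2) \<open>p > 1\<close> by simp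
  qed
  then obtain a b where range: "a \<in> {0..h}" "b \<in> {0..h}" and "?f a = ?g b" by blast
  then have "p dvd a\<^sup>2 - (- 1 - b\<^sup>2)" by (simp only: mod_eq_dvd_iff)
  then have "p dvd a\<^sup>2 + b\<^sup>2 + 1" by (simp add: algebra_simps)
  with range show thesis by (rule that)
qed

lemma four_squares_prime:
  fixes p :: int
  assumes "prime p"
  shows "four_squares p"
proof (cases "p = 2")
  case True
  then show ?thesis using four_squaresI[of 1 1 0 0] by simp
next
  case False
  have "p > 1" using assms by (rule prime_gt_1_int)
  then have "odd p" using False assms prime_odd_int[of p] by linarith
  then obtain h where p_eq: "p = 2 * h + 1" by (elim oddE)
  obtain a b where range: "a \<in> {0..h}" "b \<in> {0..h}" and dvd: "p dvd a\<^sup>2 + b\<^sup>2 + 1"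
    by (rule prime_dvd_sum_squares_plus_1[OF assms p_eq])
  obtain m where mp: "a\<^sup>2 + b\<^sup>2 + 1 = m * p" using dvd by (metis dvdE mult.commute)
  have "a\<^sup>2 \<le> h\<^sup>2" "b\<^sup>2 \<le> h\<^sup>2" using range by (auto intro: power_mono)
  then have "m * p \<le> 2 * h\<^sup>2 + 1" by (simp flip: mp)
  also have "\<dots> < (2 * h + 1)\<^sup>2"
  proof -
    have "(2 * h + 1)\<^sup>2 = 2 * h\<^sup>2 + 1 + (2 * h\<^sup>2 + 4 * h)"
      by (simp add: power2_eq_square algebra_simps)
    then show ?thesis using \<open>p > 1\<close> zero_le_power2[of h] unfolding p_eq by linarith
  qed
  also have "\<dots> = p * p" by (simp add: p_eq power2_eq_square)
  finally have "m < p" using \<open>p > 1\<close> by simp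
  have "0 < m * p" unfolding mp[symmetric] by (simp add: add_nonneg_pos)
  then have "0 < m" using \<open>p > 1\<close> by (simp add: zero_less_mult_iff)
  moreover have "four_squares (m * p)" using four_squaresI[of a b 1 0] by (simp flip: mp)
  ultimately show ?thesis using four_squares_prime_multiple[OF assms] \<open>m < p\<close> by blast
qed

theorem lagrange_four_squares: "four_squares (int n)"
proof (induction n rule: less_induct)
  case (less n)
  consider (zero) "n = 0" | (one) "n = 1" | (gt_one) "n > 1" by linarith
  then show ?case
  proof cases
    case zero
    then show ?thesis using four_squaresI[of 0 0 0 0] by simp
  next
    case one
    then show ?thesis using four_squaresI[of 1 0 0 0] by simp
  next
    case gt_one
    then obtain p where "prime p" "p dvd n" using prime_factor_nat[of n] by auto
    then obtain k where n_eq: "n = p * k" by blast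
    then have "k < n" using gt_one prime_gt_1_nat[OF \<open>prime p\<close>] by (cases "k = 0") simp_all
    then have "four_squares (int p * int k)"
      using \<open>prime p\<close> by (intro four_squares_mult four_squares_prime less.IH) simp
    then show ?thesis by (simp add: n_eq)
  qed
qed

section \<open>Shells of shifted lattices\<close>

definition lattice_shell :: "real \<Rightarrow> nat \<Rightarrow> real \<Rightarrow> (nat \<Rightarrow> real) set" where
  "lattice_shell \<delta> n m = {x \<in> coord_vectors n (shifted_ints \<delta>). (\<Sum>i<n. (x i)\<^sup>2) = m}"

lemma cubic_shell_eq: "cubic_shell n m = lattice_shell 0 n m"
  by (simp add: cubic_shell_def lattice_shell_def coord_vectors_def shifted_ints_def)

lemma shadow_shell_eq: "shadow_shell n m = lattice_shell (1/2) n m"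
  by (simp add: shadow_shell_def lattice_shell_def coord_vectors_def shifted_ints_def)

lemma sum_squares_eq_floor_sq:
  assumes "2 * \<delta> \<in> \<int>" "x \<in> coord_vectors n (shifted_ints \<delta>)"
  shows "(\<Sum>i<n. (x i)\<^sup>2) = real (\<Sum>i<n. floor_sq (x i)) + real n * frac (\<delta>\<^sup>2)"
proof -
  have "(\<Sum>i<n. (x i)\<^sup>2) = (\<Sum>i<n. real (floor_sq (x i)) + frac (\<delta>\<^sup>2))"
    using assms(2)
    by (intro sum.cong[OF refl] square_eq_floor_sq[OF assms(1)]) (simp add: coord_vectors_def)
  then show ?thesis by (simp add: sum.distrib)
qed

lemma lattice_shell_norm:
  assumes "2 * \<delta> \<in> \<int>" "lattice_shell \<delta> n m \<noteq> {}"
  obtains M where "m = real M + real n * frac (\<delta>\<^sup>2)"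
  using assms(2) sum_squares_eq_floor_sq[OF assms(1)] that unfolding lattice_shell_def by blast

context
  fixes \<delta> m :: real and n M :: nat
  assumes half_int: "2 * \<delta> \<in> \<int>" and norm_eq: "m = real M + real n * frac (\<delta>\<^sup>2)"
begin

lemma lattice_shell_fibre:
  "lattice_shell \<delta> n m = {x. x \<in> coord_vectors n (shifted_ints \<delta>) \<and> (\<Sum>i<n. floor_sq (x i)) = M}"
  using sum_squares_eq_floor_sq[OF half_int]
  by (auto simp: lattice_shell_def norm_eq simp del: of_nat_sum)

lemma moment_lattice_shell: "moment n (lattice_shell \<delta> n m) \<alpha> = (\<Prod>i<n. theta \<delta> (\<alpha> i)) $ M"
  unfolding moment_def lattice_shell_fibre theta_def
    gen_fun_prod[OF finite_fibres_shifted_ints] gen_fun_nth ..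

lemma lattice_shell_product_moments:
  "product_moments (\<lambda>f. (theta \<delta> 0 ^ n * f) $ M) n (lattice_shell \<delta> n m) (theta_ratio \<delta>)"
proof unfold_locales
  fix \<alpha> :: "nat \<Rightarrow> nat"
  have "(\<Prod>i<n. theta \<delta> (\<alpha> i)) = (\<Prod>i<n. theta_ratio \<delta> (\<alpha> i) * theta \<delta> 0)"
    by (rule prod.cong[OF refl theta_eq_ratio])
  then show "moment n (lattice_shell \<delta> n m) \<alpha> = (theta \<delta> 0 ^ n * (\<Prod>i<n. theta_ratio \<delta> (\<alpha> i))) $ M"
    by (simp add: moment_lattice_shell prod.distrib mult.commute)
qed (simp_all add: distrib_left theta_ratio_0 theta_ratio_odd[OF half_int])

lemma antipodal_spherical_lattice_shell:
  assumes "lattice_shell \<delta> n m \<noteq> {}"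
  shows "antipodal_spherical n (lattice_shell \<delta> n m)"
  unfolding antipodal_spherical_def
proof (intro conjI ballI)
  show "finite (lattice_shell \<delta> n m)"
    using finite_fibres_coord_vectors[OF finite_fibres_shifted_ints, of n \<delta>]
    unfolding lattice_shell_fibre finite_fibres_def by blast
  have "\<delta> + \<delta> \<in> \<int>" using half_int by simp
  then show "(\<lambda>i. - x i) \<in> lattice_shell \<delta> n m" if "x \<in> lattice_shell \<delta> n m" for x
    using that by (auto simp: lattice_shell_def coord_vectors_def intro: shifted_ints_uminus)
qed (use assms in \<open>auto simp: lattice_shell_def coord_vectors_def\<close>)

lemma sph_design_3_lattice_shell:
  assumes "lattice_shell \<delta> n m \<noteq> {}"
  shows "sph_design n (lattice_shell \<delta> n m) 3"
proof -
  have "2 * j = 2" if "1 \<le> j" "2 * j \<le> 3" for j :: nat using that by presburger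
  then show ?thesis
    using antipodal_spherical_lattice_shell[OF assms] lattice_shell_product_moments
    unfolding sph_design_def by (metis product_moments.design_cond_2)
qed

lemma sph_design_5_lattice_shell:
  assumes "lattice_shell \<delta> n m \<noteq> {}" "(theta \<delta> 0 ^ n * (8 * cumulant4 (theta_ratio \<delta>))) $ M = 0"
  shows "sph_design n (lattice_shell \<delta> n m) 5"
proof -
  interpret product_moments "\<lambda>f. (theta \<delta> 0 ^ n * f) $ M" n "lattice_shell \<delta> n m" "theta_ratio \<delta>"
    by (rule lattice_shell_product_moments)
  have "2 * j = 2 \<or> 2 * j = 4" if "1 \<le> j" "2 * j \<le> 5" for j :: nat using that by presburger
  moreover have "(theta \<delta> 0 ^ n * (8 * cumulant4 (theta_ratio \<delta>))) $ M =
      8 * (theta \<delta> 0 ^ n * cumulant4 (theta_ratio \<delta>)) $ M"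
    by (rule numeral_mult)
  then have "design_cond n (lattice_shell \<delta> n m) 4" using assms(2) by (intro design_cond_4) simp
  ultimately show ?thesis
    using antipodal_spherical_lattice_shell[OF assms(1)] design_cond_2
    unfolding sph_design_def by metis
qed

lemma sph_half_design_1_lattice_shell:
  assumes "lattice_shell \<delta> n m \<noteq> {}"
    and "n \<le> 2 \<or> (theta \<delta> 0 ^ n * (8 * cumulant6 (theta_ratio \<delta>))) $ M = 0"
  shows "sph_half_design n (lattice_shell \<delta> n m) 1"
proof -
  interpret product_moments "\<lambda>f. (theta \<delta> 0 ^ n * f) $ M" n "lattice_shell \<delta> n m" "theta_ratio \<delta>"
    by (rule lattice_shell_product_moments)
  have "2 * j = 2" if "1 \<le> j" "2 * j \<le> 2 * 1" for j :: nat using that by presburger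
  moreover have "(theta \<delta> 0 ^ n * (8 * cumulant6 (theta_ratio \<delta>))) $ M =
      8 * (theta \<delta> 0 ^ n * cumulant6 (theta_ratio \<delta>)) $ M"
    by (rule numeral_mult)
  then have "design_cond n (lattice_shell \<delta> n m) (2 * 1 + 4)" using assms(2) design_cond_6 by simp
  ultimately show ?thesis
    using antipodal_spherical_lattice_shell[OF assms(1)] design_cond_2
    unfolding sph_half_design_def by metis
qed

end

lemma cubic_shell_sph_design_3:
  assumes "cubic_shell n m \<noteq> {}"
  shows "sph_design n (cubic_shell n m) 3"
  using assms lattice_shell_norm[OF double_in_Ints(1)]
    sph_design_3_lattice_shell[OF double_in_Ints(1)]
  unfolding cubic_shell_eq by metis

lemma shadow_shell_sph_design_3:
  assumes "shadow_shell n m \<noteq> {}"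
  shows "sph_design n (shadow_shell n m) 3"
  using assms lattice_shell_norm[OF double_in_Ints(2)]
    sph_design_3_lattice_shell[OF double_in_Ints(2)]
  unfolding shadow_shell_eq by metis

lemma cubic_shell_2_sph_half_design:
  assumes "cubic_shell 2 m \<noteq> {}"
  shows "sph_half_design 2 (cubic_shell 2 m) 1"
  using assms lattice_shell_norm[OF double_in_Ints(1)]
    sph_half_design_1_lattice_shell[OF double_in_Ints(1)]
  unfolding cubic_shell_eq by (metis order_refl)

lemma shadow_shell_2_sph_half_design:
  assumes "shadow_shell 2 m \<noteq> {}"
  shows "sph_half_design 2 (shadow_shell 2 m) 1"
  using assms lattice_shell_norm[OF double_in_Ints(2)]
    sph_half_design_1_lattice_shell[OF double_in_Ints(2)]
  unfolding shadow_shell_eq by (metis order_refl)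

lemma cubic_shell_nonempty:
  assumes "4 \<le> n"
  shows "cubic_shell n (real M) \<noteq> {}"
proof -
  obtain a :: "nat \<Rightarrow> int" where sum_a: "int M = (\<Sum>i<4. (a i)\<^sup>2)"
    using lagrange_four_squares[of M] unfolding four_squares_def by blast
  define x where "x i = (if i < 4 then of_int (a i) else 0 :: real)" for i
  have "(\<Sum>i<n. (x i)\<^sup>2) = (\<Sum>i<4. (of_int (a i))\<^sup>2)"
    using assms by (intro sum.mono_neutral_cong_right) (auto simp: x_def)
  also have "\<dots> = real M" using arg_cong[OF sum_a, of real_of_int] by simp
  finally have "x \<in> cubic_shell n (real M)" using assms by (auto simp: cubic_shell_def x_def)
  then show ?thesis by blast
qed

lemma shadow_shell_nonempty:
  assumes "8 \<le> n"
  shows "shadow_shell n (2 * real M + real n / 4) \<noteq> {}"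
proof -
  obtain a :: "nat \<Rightarrow> int" where sum_a: "int M = (\<Sum>i<4. (a i)\<^sup>2)"
    using lagrange_four_squares[of M] unfolding four_squares_def by blast
  define k where "k i = (if i < 4 then a i else if i < 8 then a (i - 4) - 1 else 0)" for i
  define x where "x i = (if i < n then of_int (k i) + 1/2 else 0 :: real)" for i
  have "(\<Sum>i<n. (x i)\<^sup>2) = (\<Sum>i<n. of_int (k i * (k i + 1)) + 1/4)"
    by (intro sum.cong[OF refl]) (simp add: x_def power2_eq_square algebra_simps)
  also have "\<dots> = of_int (\<Sum>i<n. k i * (k i + 1)) + real n / 4" by (simp add: sum.distrib)
  also have "(\<Sum>i<n. k i * (k i + 1)) = (\<Sum>i<8. k i * (k i + 1))"
    using assms by (intro sum.mono_neutral_right) (auto simp: k_def)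
  also have "\<dots> = 2 * int M"
    by (simp add: sum_a k_def numeral_eq_Suc power2_eq_square algebra_simps)
  finally have "x \<in> shadow_shell n (2 * real M + real n / 4)" by (simp add: shadow_shell_def x_def)
  then show ?thesis by blast
qed

lemma cubic_shell_sph_design_5:
  assumes "4 \<le> n" "(theta3 ^ n * (jac2 * jac4)) $ M = 0"
  shows "sph_design n (cubic_shell n (real M)) 5"
  using sph_design_5_lattice_shell[OF double_in_Ints(1), of "real M" M n]
    cubic_shell_nonempty[OF assms(1), of M] assms(2)
  by (simp add: cubic_shell_eq cumulant4_theta3)

lemma cubic_shell_sph_half_design:
  assumes "4 \<le> n" "(theta3 ^ n * (jac2 * jac4 * (jac4 - jac2))) $ M = 0"
  shows "sph_half_design n (cubic_shell n (real M)) 1"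
  using sph_half_design_1_lattice_shell[OF double_in_Ints(1), of "real M" M n]
    cubic_shell_nonempty[OF assms(1), of M] assms(2)
  by (simp add: cubic_shell_eq cumulant6_theta3)

context
  fixes k m M :: nat
  assumes two_le_k: "2 \<le> k" and m_eq: "m = 2 * M + k"
begin

lemma half_lattice_shell_nonempty: "lattice_shell (1/2) (4 * k) (real m) \<noteq> {}"
  using shadow_shell_nonempty[of "4 * k" M] two_le_k by (simp add: m_eq shadow_shell_eq)

lemma half_lattice_shell_norm: "real m = real (2 * M) + real (4 * k) * frac ((1/2)\<^sup>2)"
  by (simp add: m_eq frac_half_square)

lemma theta2_power_nth: "(theta2 ^ (4 * k) * f) $ (2 * M) = (jac2 ^ k * f) $ m"
  by (simp add: m_eq jac2_power fps_X_power_mult_nth mult.assoc)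

lemma shadow_shell_sph_design_5:
  assumes "(jac2 ^ k * (jac4 * jac3)) $ m = 0"
  shows "sph_design (4 * k) (shadow_shell (4 * k) (real m)) 5"
  unfolding shadow_shell_eq
  by (rule sph_design_5_lattice_shell[OF double_in_Ints(2) half_lattice_shell_norm
        half_lattice_shell_nonempty])
    (simp add: assms cumulant4_theta2 theta2_power_nth)

lemma shadow_shell_sph_half_design:
  assumes "(jac2 ^ k * (jac4 * jac3 * (jac4 + jac3))) $ m = 0"
  shows "sph_half_design (4 * k) (shadow_shell (4 * k) (real m)) 1"
  unfolding shadow_shell_eq
  by (rule sph_half_design_1_lattice_shell[OF double_in_Ints(2) half_lattice_shell_norm
        half_lattice_shell_nonempty])
    (simp add: assms cumulant6_theta2 theta2_power_nth)

end

lemma cubic_shell_4_sph_design_5: "sph_design 4 (cubic_shell 4 (2 * real a)) 5"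
proof -
  have "(theta3 ^ 4 * (jac2 * jac4)) $ (2 * a) = 0"
    using jac_product_nth_even_eq_0[of a] by (simp add: jac3_def)
  then show ?thesis using cubic_shell_sph_design_5[of 4 "2 * a"] by simp
qed

lemma cubic_shell_7_sph_design_5: "sph_design 7 (cubic_shell 7 (4 ^ a * (8 * real b + 3))) 5"
  using cubic_shell_sph_design_5[of 7 "4 ^ a * (8 * b + 3)"] cubic7_quartic_nth_eq_0[of a b]
  by (simp add: cubic7_quartic_def)

lemma cubic_shell_16_sph_half_design: "sph_half_design 16 (cubic_shell 16 (2 * 4 ^ a)) 1"
proof -
  have "(theta3 ^ 16 * (jac2 * jac4 * (jac4 - jac2))) $ (2 * 4 ^ a) = 0"
    using jac3_pow4_sextic_nth_eq_0[of a] by (simp add: jac3_def flip: power_mult)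
  then show ?thesis using cubic_shell_sph_half_design[of 16 "2 * 4 ^ a"] by simp
qed

lemma shadow_shell_16_sph_design_5:
  assumes "1 \<le> a"
  shows "sph_design 16 (shadow_shell 16 (4 * real a + 2)) 5"
proof -
  have "4 * a + 2 = 2 * (2 * a - 1) + 4" using assms by simp
  from shadow_shell_sph_design_5[OF _ this jac2_pow4_quartic_nth_eq_0]
  show ?thesis by (simp add: add.commute)
qed

lemma shadow_shell_16_sph_half_design:
  assumes "1 \<le> a"
  shows "sph_half_design 16 (shadow_shell 16 (2 * 4 ^ a)) 1"
proof -
  have "(4::nat) ^ 1 \<le> 4 ^ a" using assms by (intro power_increasing) auto
  then have "2 * 4 ^ a = 2 * (4 ^ a - 2) + (4 :: nat)" by simp
  then show ?thesis
    using shadow_shell_sph_half_design[of 4 "2 * 4 ^ a" "4 ^ a - 2"] jac2_pow4_sextic_nth_eq_0[of a]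
    by simp
qed

lemma shadow_shell_40_sph_half_design: "sph_half_design 40 (shadow_shell 40 24) 1"
  using shadow_shell_sph_half_design[of 10 24 7] jac2_pow10_sextic_nth_eq_0 by simp

theorem theorem9p2:
  shows
  "(\<forall>n m. n \<ge> 2 \<longrightarrow>
      (cubic_shell n m \<noteq> {} \<longrightarrow> sph_design n (cubic_shell n m) 3) \<and>
      (shadow_shell n m \<noteq> {} \<longrightarrow> sph_design n (shadow_shell n m) 3))
   \<and>
   ((\<forall>m. cubic_shell 2 m \<noteq> {} \<longrightarrow> sph_half_design 2 (cubic_shell 2 m) 1) \<and>
    (\<forall>m. shadow_shell 2 m \<noteq> {} \<longrightarrow> sph_half_design 2 (shadow_shell 2 m) 1) \<and>
    (\<forall>a::nat. sph_half_design 16 (cubic_shell 16 (2 * 4 ^ a)) 1) \<and>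
    (\<forall>a::nat. a \<ge> 1 \<longrightarrow> sph_half_design 16 (shadow_shell 16 (2 * 4 ^ a)) 1) \<and>
    sph_half_design 40 (shadow_shell 40 24) 1)
   \<and>
   ((\<forall>a::nat. a \<ge> 1 \<longrightarrow> sph_design 4 (cubic_shell 4 (2 * real a)) 5) \<and>
    (\<forall>a b::nat. sph_design 7 (cubic_shell 7 (4 ^ a * (8 * real b + 3))) 5) \<and>
    (\<forall>a::nat. a \<ge> 1 \<longrightarrow> sph_design 16 (shadow_shell 16 (4 * real a + 2)) 5))"
  by (intro conjI allI impI
      cubic_shell_sph_design_3 shadow_shell_sph_design_3
      cubic_shell_2_sph_half_design shadow_shell_2_sph_half_design
      cubic_shell_16_sph_half_design shadow_shell_16_sph_half_design shadow_shell_40_sph_half_design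
      cubic_shell_4_sph_design_5 cubic_shell_7_sph_design_5 shadow_shell_16_sph_design_5)

end
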